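(* Let $\mathcal H=(V,E)$ be a connected hypergraph with a fixed ribbon structure, base node and base edge on $\mathrm{Bip}\,\mathcal H$. Run the (ht:$E$, cut:$V$) Bernardi process on a hypertree $\mathbf f$ on $E$ and let $T$ be the resulting spanning tree (final current graph). Then running the (ht:$V$, cut:$V$) Bernardi process on the hypertree $\mathbf f_V(T)$ on $V$ also results in $T$.
   Context: $\mathcal H=(V,E)$: $V$ finite set, $E$ finite multiset of nonempty subsets of $V$; $\mathrm{Bip}\,\mathcal H$ has color classes $V$ (violet) and $E$ (emerald), $v$ joined to $e$ iff $v\in e$; connected means $\mathrm{Bip}\,\mathcal H$ connected. A ribbon structure assigns to each node $x$ a cyclic permutation of its incident edges; $xy^+$ is the edge following $xy$ at $x$; subgraphs inherit restricted orders ($xy^+_G$ in subgraph $G$). Base node $b_0$, incident base edge $b_0b_1$. A hypertree on $E$ is $\mathbf f:E\to\mathbb Z_{\ge0}$ such that some spanning tree $T$ has $d_T(e)=\mathbf f(e)+1$ for all $e\in E$; symmetrically on $V$. For a spanning tree $T$, $\mathbf f_V(T)(v)=d_T(v)-1$. Bernardi process (ht:$X$, cut:$V$), $X\in\{E,V\}$, $\mathbf f$ a hypertree on $X$: current graph $G$ initially $\mathrm{Bip}\,\mathcal H$. If $b_0\in V$ start with current edge $b_0b_1$; if $b_0\in E$ start with $b_1b_0^+$, $b_0b_1$ counting as traversed from $b_0$. With current edge $ve$ ($v\in V$): if $\mathbf f$ is a hypertree on $X$ in $G-ve$, remove $ve$ and make $ve^+_G$ current; otherwise traverse $ve$ from $v$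 and $ew:=ev^+_G$ from $e$, and make $we^+_G$ current. Stop right before an edge would be traversed a second time from the same endpoint. (The final current graph is a spanning tree realizing $\mathbf f$.) *)

theory Defs
  imports "HOL-Combinatorics.Orbits"
begin

text \<open>
  The multiset of hyperedges is given as an indexed family: a finite set \<open>E\<close> of labels together
  with \<open>A e\<close>, the set of vertices in the hyperedge labelled \<open>e\<close>; distinct labels may carry the
  same set. The nodes of the bipartite graph are \<open>V <+> E\<close>, so that a violet node is \<open>Inl v\<close>
  and an emerald node is \<open>Inr e\<close>. The bipartite graph is simple, and the edge joining \<open>Inl v\<close>
  and \<open>Inr e\<close> is the pair \<open>(v, e)\<close>. All graphs below are spanning subgraphs on the fixed node set
  \<open>V <+> E\<close> and are therefore given by their edge sets.
\<close>

type_synonym ('v, 'e) bigraph = "('v \<times> 'e) set"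

definition hypergraph :: "'v set \<Rightarrow> 'e set \<Rightarrow> ('e \<Rightarrow> 'v set) \<Rightarrow> bool" where
  "hypergraph V E A \<longleftrightarrow> finite V \<and> finite E \<and> (\<forall>e\<in>E. A e \<noteq> {} \<and> A e \<subseteq> V)"

definition Bip :: "'v set \<Rightarrow> 'e set \<Rightarrow> ('e \<Rightarrow> 'v set) \<Rightarrow> ('v, 'e) bigraph" where
  "Bip V E A = {(v, e). v \<in> V \<and> e \<in> E \<and> v \<in> A e}"

definition incident :: "('v, 'e) bigraph \<Rightarrow> 'v + 'e \<Rightarrow> ('v \<times> 'e) set" where
  "incident G x = {(v, e) \<in> G. x = Inl v \<or> x = Inr e}"

definition degree :: "('v, 'e) bigraph \<Rightarrow> 'v + 'e \<Rightarrow> nat" where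
  "degree G x = card (incident G x)"

definition adj :: "('v, 'e) bigraph \<Rightarrow> (('v + 'e) \<times> ('v + 'e)) set" where
  "adj G = (\<Union>(v, e)\<in>G. {(Inl v, Inr e), (Inr e, Inl v)})"

definition connected_graph :: "'v set \<Rightarrow> 'e set \<Rightarrow> ('v, 'e) bigraph \<Rightarrow> bool" where
  "connected_graph V E G \<longleftrightarrow>
     V <+> E \<noteq> {} \<and> (\<forall>x \<in> V <+> E. \<forall>y \<in> V <+> E. (x, y) \<in> (adj G)\<^sup>*)"

text \<open>A cycle is the list of its pairwise distinct nodes, in cyclic order.\<close>

definition cycle :: "('v, 'e) bigraph \<Rightarrow> ('v + 'e) list \<Rightarrow> bool" where
  "cycle G xs \<longleftrightarrow> 3 \<le> length xs \<and> distinct xs \<and>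
     (\<forall>i < length xs. (xs ! i, xs ! (Suc i mod length xs)) \<in> adj G)"

definition spanning_tree :: "'v set \<Rightarrow> 'e set \<Rightarrow> ('v, 'e) bigraph \<Rightarrow> ('v, 'e) bigraph \<Rightarrow> bool" where
  "spanning_tree V E G T \<longleftrightarrow> T \<subseteq> G \<and> connected_graph V E T \<and> (\<nexists>xs. cycle T xs)"

text \<open>\<open>f\<close> is a hypertree on \<open>E\<close> (respectively on \<open>V\<close>) in the spanning subgraph \<open>G\<close>.\<close>

definition hypertree_E :: "'v set \<Rightarrow> 'e set \<Rightarrow> ('e \<Rightarrow> nat) \<Rightarrow> ('v, 'e) bigraph \<Rightarrow> bool" where
  "hypertree_E V E f G \<longleftrightarrow>
     (\<exists>T. spanning_tree V E G T \<and> (\<forall>e\<in>E. degree T (Inr e) = f e + 1))"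

definition hypertree_V :: "'v set \<Rightarrow> 'e set \<Rightarrow> ('v \<Rightarrow> nat) \<Rightarrow> ('v, 'e) bigraph \<Rightarrow> bool" where
  "hypertree_V V E f G \<longleftrightarrow>
     (\<exists>T. spanning_tree V E G T \<and> (\<forall>v\<in>V. degree T (Inl v) = f v + 1))"

text \<open>
  The subtraction does not truncate for a spanning tree \<open>T\<close> of a graph with at least one edge,
  as there all degrees are positive.
\<close>

definition f_V :: "('v, 'e) bigraph \<Rightarrow> 'v \<Rightarrow> nat" where
  "f_V T v = degree T (Inl v) - 1"

definition ribbon_structure ::
    "'v set \<Rightarrow> 'e set \<Rightarrow> ('v, 'e) bigraph \<Rightarrow> ('v + 'e \<Rightarrow> 'v \<times> 'e \<Rightarrow> 'v \<times> 'e) \<Rightarrow> bool" where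
  "ribbon_structure V E B \<rho> \<longleftrightarrow>
     (\<forall>x \<in> V <+> E. \<rho> x permutes incident B x \<and> cyclic_on (\<rho> x) (incident B x))"

text \<open>
  \<open>next_edge \<rho> G x d\<close> is the edge following \<open>d\<close> at \<open>x\<close> in the cyclic order restricted to the
  subgraph \<open>G\<close>. If \<open>d\<close> is the only edge of \<open>G\<close> at \<open>x\<close>, it is \<open>d\<close> itself.
\<close>

definition next_edge ::
    "('v + 'e \<Rightarrow> 'v \<times> 'e \<Rightarrow> 'v \<times> 'e) \<Rightarrow> ('v, 'e) bigraph \<Rightarrow> 'v + 'e \<Rightarrow> 'v \<times> 'e \<Rightarrow> 'v \<times> 'e" where
  "next_edge \<rho> G x d = (\<rho> x ^^ (LEAST n. 0 < n \<and> (\<rho> x ^^ n) d \<in> incident G x)) d"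

text \<open>
  A state \<open>(G, d, D)\<close> of the process consists of the current graph \<open>G\<close>, the current edge \<open>d\<close>, and
  the set \<open>D\<close> of all pairs \<open>(x, d')\<close> such that \<open>d'\<close> has been traversed from its endpoint \<open>x\<close>.
  The predicate \<open>P\<close> says of a graph that the given function is a hypertree in it.
  No step is possible from a state in which every continuation would traverse an edge for the
  second time from the same endpoint. This may happen at \<open>(v, e)\<close>, or only at the following edge
  \<open>(w, e)\<close>; since traversals leave the graph unchanged, the final graph is \<open>G\<close> in both cases.
\<close>

type_synonym ('v, 'e) state =
  "('v, 'e) bigraph \<times> ('v \<times> 'e) \<times> (('v + 'e) \<times> ('v \<times> 'e)) set"

inductive cutV_step ::
    "('v + 'e \<Rightarrow> 'v \<times> 'e \<Rightarrow> 'v \<times> 'e) \<Rightarrow> (('v, 'e) bigraph \<Rightarrow> bool) \<Rightarrow>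
     ('v, 'e) state \<Rightarrow> ('v, 'e) state \<Rightarrow> bool"
  for \<rho> P where
  remove:
    "P (G - {(v, e)}) \<Longrightarrow>
     cutV_step \<rho> P (G, (v, e), D) (G - {(v, e)}, next_edge \<rho> G (Inl v) (v, e), D)"
| traverse:
    "\<lbrakk>\<not> P (G - {(v, e)}); (Inl v, (v, e)) \<notin> D;
      next_edge \<rho> G (Inr e) (v, e) = (w, e); (Inr e, (w, e)) \<notin> D\<rbrakk> \<Longrightarrow>
     cutV_step \<rho> P (G, (v, e), D)
       (G, next_edge \<rho> G (Inl w) (w, e), D \<union> {(Inl v, (v, e)), (Inr e, (w, e))})"

text \<open>The base node \<open>b\<^sub>0\<close> is one of the two endpoints of the base edge \<open>d\<^sub>0\<close>.\<close>

fun cutV_start ::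
    "('v + 'e \<Rightarrow> 'v \<times> 'e \<Rightarrow> 'v \<times> 'e) \<Rightarrow> ('v, 'e) bigraph \<Rightarrow> 'v + 'e \<Rightarrow> 'v \<times> 'e \<Rightarrow> ('v, 'e) state" where
  "cutV_start \<rho> B (Inl v) d\<^sub>0 = (B, d\<^sub>0, {})"
| "cutV_start \<rho> B (Inr e) d\<^sub>0 = (B, next_edge \<rho> B (Inl (fst d\<^sub>0)) d\<^sub>0, {(Inr e, d\<^sub>0)})"

definition cutV_result ::
    "('v + 'e \<Rightarrow> 'v \<times> 'e \<Rightarrow> 'v \<times> 'e) \<Rightarrow> (('v, 'e) bigraph \<Rightarrow> bool) \<Rightarrow> ('v, 'e) bigraph \<Rightarrow>
     'v + 'e \<Rightarrow> 'v \<times> 'e \<Rightarrow> ('v, 'e) bigraph \<Rightarrow> bool" where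
  "cutV_result \<rho> P B b\<^sub>0 d\<^sub>0 T \<longleftrightarrow>
     (\<exists>d D. (cutV_step \<rho> P)\<^sup>*\<^sup>* (cutV_start \<rho> B b\<^sub>0 d\<^sub>0) (T, d, D) \<and>
            (\<nexists>s. cutV_step \<rho> P (T, d, D) s))"

text \<open>\<open>bernardi_EV\<close> is the (ht:\<open>E\<close>, cut:\<open>V\<close>) process, \<open>bernardi_VV\<close> the (ht:\<open>V\<close>, cut:\<open>V\<close>) process.\<close>

definition bernardi_EV where
  "bernardi_EV V E A \<rho> b\<^sub>0 d\<^sub>0 f T \<longleftrightarrow>
     cutV_result \<rho> (hypertree_E V E f) (Bip V E A) b\<^sub>0 d\<^sub>0 T"

definition bernardi_VV where
  "bernardi_VV V E A \<rho> b\<^sub>0 d\<^sub>0 f T \<longleftrightarrow>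
     cutV_result \<rho> (hypertree_V V E f) (Bip V E A) b\<^sub>0 d\<^sub>0 T"

end

theory Submission
  imports Defs
begin

text \<open>
  The (ht:\<open>E\<close>, cut:\<open>V\<close>) process is a depth-first search. The edges traversed so far never close a
  cycle: an edge first traversed from its violet endpoint, or traversed both ways, lies in every
  realization of \<open>f\<close> in the current graph, and each emerald node has at most one other traversed
  edge, so by an exchange argument some realization contains all traversed edges.

  It remains to see that both processes take the same decision at every current edge \<open>ve\<close>. If \<open>ve\<close>
  is removed, then \<open>T\<close> avoids it and realizes \<open>f\<^sub>V(T)\<close> without it. If \<open>ve\<close> is kept and had been
  entered from \<open>e\<close>, it is a bridge of the current graph. If it is kept and is first traversed from
  \<open>v\<close>, let \<open>S\<close> be the set of nodes visited from then on until the search returns to \<open>v\<close>. Apart from \<open>ve\<close>, the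
  graph at the time of the decision has no edge from an emerald node of \<open>S\<close> to a violet node outside
  \<open>S\<close>, so a spanning tree avoiding \<open>ve\<close> has at least \<open>|S|\<close> edges at the violet nodes of \<open>S\<close>,
  whereas \<open>T\<close> has only \<open>|S| - 1\<close>.
\<close>

section \<open>Cuts and spanning trees\<close>

definition crosses :: "('v + 'e) set \<Rightarrow> 'v \<times> 'e \<Rightarrow> bool" where
  "crosses S d \<longleftrightarrow> (Inl (fst d) \<in> S) \<noteq> (Inr (snd d) \<in> S)"

definition touches :: "('v + 'e) set \<Rightarrow> 'v \<times> 'e \<Rightarrow> bool" where
  "touches S d \<longleftrightarrow> Inl (fst d) \<in> S \<or> Inr (snd d) \<in> S"

lemma adj_iff:
  "(x, y) \<in> adj G \<longleftrightarrow> (\<exists>v e. (v, e) \<in> G \<and> (x = Inl v \<and> y = Inr e \<or> x = Inr e \<and> y = Inl v))"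
  unfolding adj_def by auto

lemma adj_sym: "(x, y) \<in> adj G \<Longrightarrow> (y, x) \<in> adj G"
  unfolding adj_iff by blast

lemma path_crosses:
  assumes "(x, y) \<in> (adj G)\<^sup>*" and "(x \<in> S) \<noteq> (y \<in> S)"
  shows "\<exists>d\<in>G. crosses S d"
  using assms
proof (induction rule: rtrancl_induct)
  case (step y z)
  show ?case
  proof (cases "(y \<in> S) = (z \<in> S)")
    case True
    then show ?thesis using step by blast
  next
    case False
    obtain v e where "(v, e) \<in> G" "y = Inl v \<and> z = Inr e \<or> y = Inr e \<and> z = Inl v"
      using step.hyps(2) unfolding adj_iff by blast
    then show ?thesis using False by (intro bexI[of _ "(v, e)"]) (auto simp: crosses_def)
  qed
qed auto

text \<open>For the converse, the set of nodes reachable from \<open>x\<close> is a cut that no edge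
  crosses. In this form connectivity passes to larger graphs at once, and an edge exchange is
  checked on single cuts.\<close>

lemma connected_graph_iff_cut:
  "connected_graph V E G \<longleftrightarrow> V <+> E \<noteq> {} \<and>
     (\<forall>S. (\<exists>x \<in> V <+> E. x \<in> S) \<and> (\<exists>y \<in> V <+> E. y \<notin> S) \<longrightarrow> (\<exists>d\<in>G. crosses S d))"
  (is "?L \<longleftrightarrow> ?R")
proof
  assume ?L
  then show ?R unfolding connected_graph_def by (meson path_crosses)
next
  assume R: ?R
  have "(x, y) \<in> (adj G)\<^sup>*" if xy: "x \<in> V <+> E" "y \<in> V <+> E" for x y
  proof (rule ccontr)
    assume n: "(x, y) \<notin> (adj G)\<^sup>*"
    let ?S = "{z. (x, z) \<in> (adj G)\<^sup>*}"
    have "x \<in> ?S" "y \<notin> ?S" using n by auto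
    then have "\<exists>d\<in>G. crosses ?S d" using xy R[THEN conjunct2, rule_format, of ?S] by blast
    then obtain v e where d: "(v, e) \<in> G" and c: "crosses ?S (v, e)" by auto
    have "(Inl v, Inr e) \<in> adj G" "(Inr e, Inl v) \<in> adj G" using d unfolding adj_iff by auto
    then show False using c unfolding crosses_def by (auto intro: rtrancl_into_rtrancl)
  qed
  then show ?L using R unfolding connected_graph_def by blast
qed

lemma connected_crosses:
  assumes "connected_graph V E G" and "x \<in> V <+> E" "x \<in> S" "y \<in> V <+> E" "y \<notin> S"
  obtains d where "d \<in> G" "crosses S d"
  using assms unfolding connected_graph_iff_cut by blast

lemma connected_graph_mono:
  "connected_graph V E G \<Longrightarrow> G \<subseteq> H \<Longrightarrow> connected_graph V E H"
  unfolding connected_graph_iff_cut by blast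

text \<open>An edge leaving \<open>S\<close> has only one endpoint \<open>z\<close> in
  \<open>S\<close>, so deleting \<open>z\<close> from \<open>S\<close> loses at least this touching
  edge. Such an edge exists because \<open>S\<close> is a nonempty proper subset in every
  step.\<close>

lemma card_touching:
  assumes G: "connected_graph V E G" "finite G" and fin: "finite S"
    and S: "S \<subset> V <+> E"
  shows "card S \<le> card {d \<in> G. touches S d}"
  using fin S
proof (induction "card S" arbitrary: S)
  case (Suc k)
  obtain x y where x: "x \<in> S" "x \<in> V <+> E" and y: "y \<in> V <+> E" "y \<notin> S"
  proof -
    have "S \<noteq> {}" using Suc.hyps(2) by auto
    then show thesis using that Suc.prems(2) by blast
  qed
  obtain d where d: "d \<in> G" "crosses S d" using connected_crosses[OF G(1) x(2,1) y] .
  obtain z where z: "z \<in> S" "\<not> touches (S - {z}) d"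
    using d(2) unfolding crosses_def touches_def by blast
  have "card (S - {z}) \<le> card {d \<in> G. touches (S - {z}) d}"
    using Suc z(1) by (intro Suc.hyps(1)) auto
  moreover have "{d \<in> G. touches (S - {z}) d} \<subset> {d \<in> G. touches S d}"
    using d z(2) unfolding crosses_def touches_def by blast
  then have "card {d \<in> G. touches (S - {z}) d} < card {d \<in> G. touches S d}"
    using G(2) by (intro psubset_card_mono) auto
  moreover have "card S = Suc (card (S - {z}))" using z(1) Suc.prems(1) by (metis card_Suc_Diff1)
  ultimately show ?case by linarith
qed auto

lemma card_connected:
  assumes "connected_graph V E G" "finite G" "finite V" "finite E"
  shows "card (V <+> E) \<le> card G + 1"
proof -
  obtain x where x: "x \<in> V <+> E" using assms(1) unfolding connected_graph_def by blast
  \<comment> \<open>One node is left out because \<open>card_touching\<close> needs a proper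
    subset.\<close>
  have "card (V <+> E - {x}) \<le> card {d \<in> G. touches (V <+> E - {x}) d}"
    using x assms by (intro card_touching) auto
  also have "\<dots> \<le> card G" using assms(2) by (intro card_mono) auto
  finally show ?thesis using x assms(3,4) by (simp add: card_Diff_singleton)
qed

text \<open>A tree is grown from one node along crossing edges: \<open>X\<close> holds the
  \<open>k + 1\<close> nodes reached and \<open>F\<close> the \<open>k\<close> edges used, and
  \<open>F\<close> crosses every cut that separates \<open>X\<close>.\<close>

lemma ex_connected_card:
  assumes G: "connected_graph V E G" "G \<subseteq> V \<times> E" and fin: "finite V" "finite E"
  shows "\<exists>T\<subseteq>G. connected_graph V E T \<and> card T + 1 = card (V <+> E)"
proof -
  have finG: "finite G" using G(2) fin by (meson finite_SigmaI finite_subset)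
  have grow: "\<exists>X F. X \<subseteq> V <+> E \<and> card X = Suc k \<and> F \<subseteq> G \<and> card F = k \<and>
      (\<forall>d\<in>F. Inl (fst d) \<in> X \<and> Inr (snd d) \<in> X) \<and>
      (\<forall>S. S \<inter> X \<noteq> {} \<and> X - S \<noteq> {} \<longrightarrow> (\<exists>d\<in>F. crosses S d))"
    if "Suc k \<le> card (V <+> E)" for k
    using that
  proof (induction k)
    case 0
    obtain x where "x \<in> V <+> E" using G(1) unfolding connected_graph_def by blast
    then show ?case by (intro exI[of _ "{x}"] exI[of _ "{}"]) auto
  next
    case (Suc k)
    then obtain X F where X: "X \<subseteq> V <+> E" "card X = Suc k" and F: "F \<subseteq> G" "card F = k"
      and FX: "\<forall>d\<in>F. Inl (fst d) \<in> X \<and> Inr (snd d) \<in> X"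
      and cut: "\<And>S. S \<inter> X \<noteq> {} \<Longrightarrow> X - S \<noteq> {} \<Longrightarrow> \<exists>d\<in>F. crosses S d"
      by (metis Suc_leD)
    have "X \<noteq> V <+> E" using X(2) Suc.prems by auto
    then obtain y where y: "y \<in> V <+> E" "y \<notin> X" using X(1) by blast
    have "X \<noteq> {}" using X(2) by auto
    then obtain x where x: "x \<in> V <+> E" "x \<in> X" using X(1) by blast
    obtain d where d: "d \<in> G" "crosses X d" using connected_crosses[OF G(1) x y] .
    define a b where "a = (if Inl (fst d) \<in> X then Inl (fst d) else Inr (snd d))"
      and "b = (if Inl (fst d) \<in> X then Inr (snd d) else Inl (fst d))"
    have ab: "a \<in> X" "b \<notin> X" using d(2) unfolding a_def b_def crosses_def by auto
    have bN: "b \<in> V <+> E" using d(1) G(2) unfolding b_def by auto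
    have crossd: "crosses S d \<longleftrightarrow> (a \<in> S) \<noteq> (b \<in> S)" for S
      unfolding a_def b_def crosses_def by auto
    have ends: "Inl (fst d) \<in> insert b X" "Inr (snd d) \<in> insert b X"
      using ab(1) unfolding a_def b_def by auto
    have "d \<notin> F" using FX ab(2) unfolding b_def by auto
    moreover have "finite X" "finite F" using X F finG fin
      by (metis finite_Plus finite_subset)+
    \<comment> \<open>A cut separating \<open>X\<close> is crossed by an old edge. Otherwise
      \<open>X\<close> lies on one side and \<open>b\<close> on the other, so the new edge
      crosses.\<close>
    moreover have "\<exists>d\<in>insert d F. crosses S d"
      if S: "S \<inter> insert b X \<noteq> {}" "insert b X - S \<noteq> {}" for S
    proof (cases "S \<inter> X \<noteq> {} \<and> X - S \<noteq> {}")
      case True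
      then show ?thesis using cut by blast
    next
      case False
      then have "(a \<in> S) \<noteq> (b \<in> S)" using S ab by blast
      then show ?thesis using crossd by blast
    qed
    moreover have "\<forall>d\<in>insert d F. Inl (fst d) \<in> insert b X \<and> Inr (snd d) \<in> insert b X"
      using FX ends by blast
    moreover have "card (insert b X) = Suc (Suc k)" "card (insert d F) = Suc k"
      using calculation X(2) F(2) ab(2) by simp_all
    moreover have "insert b X \<subseteq> V <+> E" "insert d F \<subseteq> G" using X(1) F(1) bN d(1) by blast+
    ultimately show ?case by blast
  qed
  have N: "card (V <+> E) > 0" using G(1) fin unfolding connected_graph_def by (simp add: card_gt_0_iff)
  then obtain k where k: "card (V <+> E) = Suc k" by (metis gr0_implies_Suc)
  obtain X F where X: "X \<subseteq> V <+> E" "card X = Suc k" and F: "F \<subseteq> G" "card F = k"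
    and cut: "\<And>S. S \<inter> X \<noteq> {} \<Longrightarrow> X - S \<noteq> {} \<Longrightarrow> \<exists>d\<in>F. crosses S d"
    using grow[of k] k by (metis order_refl)
  have "X = V <+> E" using X k fin by (metis card_subset_eq finite_Plus)
  then have "connected_graph V E F" unfolding connected_graph_iff_cut using cut N
    by (metis Diff_iff IntI card_gt_0_iff ex_in_conv)
  then show ?thesis using F k by auto
qed

section \<open>Acyclicity and the edge count\<close>

lemma rtrancl_distinct_path:
  assumes "(x, y) \<in> r\<^sup>*"
  shows "\<exists>xs. xs \<noteq> [] \<and> hd xs = x \<and> last xs = y \<and> distinct xs \<and>
    successively (\<lambda>a b. (a, b) \<in> r) xs"
  using assms
proof (induction rule: converse_rtrancl_induct)
  case base
  then show ?case by (intro exI[of _ "[y]"]) auto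
next
  case (step x z)
  then obtain xs where xs: "xs \<noteq> []" "hd xs = z" "last xs = y" "distinct xs"
    "successively (\<lambda>a b. (a, b) \<in> r) xs" by blast
  show ?case
  proof (cases "x \<in> set xs")
    case True
    then obtain ys zs where "xs = ys @ x # zs" by (meson split_list)
    then show ?thesis using xs
      by (intro exI[of _ "x # zs"]) (auto simp: successively_append_iff)
  next
    case False
    then show ?thesis using xs step.hyps(1)
      by (intro exI[of _ "x # xs"]) (auto simp: successively_Cons)
  qed
qed

lemma cycle_of_path:
  assumes "(v, e) \<in> T" and "(Inl v, Inr e) \<in> (adj (T - {(v, e)}))\<^sup>*"
  shows "\<exists>xs. cycle T xs"
proof -
  obtain xs where xs: "xs \<noteq> []" "hd xs = Inl v" "last xs = Inr e" "distinct xs"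
    "successively (\<lambda>a b. (a, b) \<in> adj (T - {(v, e)})) xs"
    using rtrancl_distinct_path[OF assms(2)] by blast
  have nth: "(xs ! i, xs ! Suc i) \<in> adj (T - {(v, e)})" if "Suc i < length xs" for i
    using xs(5) that by (simp add: successively_conv_nth)
  have ends: "xs ! 0 = Inl v" "xs ! (length xs - 1) = Inr e"
    using xs by (simp_all add: hd_conv_nth last_conv_nth)
  have "length xs \<noteq> 1" using ends by auto
  \<comment> \<open>A path with two nodes would consist of the removed edge \<open>(v, e)\<close>
    itself, since the graph is simple.\<close>
  moreover have "length xs \<noteq> 2" using nth[of 0] ends unfolding adj_iff by auto
  moreover have "length xs \<noteq> 0" using xs(1) by simp
  ultimately have len: "3 \<le> length xs" by linarith
  have "(xs ! i, xs ! (Suc i mod length xs)) \<in> adj T" if "i < length xs" for i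
  proof (cases "Suc i < length xs")
    case True
    then show ?thesis using nth[of i] unfolding adj_iff by auto
  next
    case False
    then have "Suc i = length xs" using that by linarith
    then have "i = length xs - 1" "Suc i mod length xs = 0" by simp_all
    then show ?thesis using ends assms(1) unfolding adj_iff by auto
  qed
  then show ?thesis using len xs(4) unfolding cycle_def by blast
qed

text \<open>The closing edge of the cycle is dispensable: the rest of the cycle joins its endpoints
  and so crosses every cut that the closing edge crosses.\<close>

lemma cycle_removable:
  assumes "cycle T xs" and T: "connected_graph V E T"
  shows "\<exists>d\<in>T. connected_graph V E (T - {d})"
proof -
  let ?n = "length xs"
  have len: "3 \<le> ?n" and dist: "distinct xs"
    and nth: "\<And>i. i < ?n \<Longrightarrow> (xs ! i, xs ! (Suc i mod ?n)) \<in> adj T"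
    using assms(1) unfolding cycle_def by auto
  have "(xs ! (?n - 1), xs ! 0) \<in> adj T" using nth[of "?n - 1"] len
    by (cases ?n) auto
  then obtain v e where d: "(v, e) \<in> T" and
    "xs ! (?n - 1) = Inl v \<and> xs ! 0 = Inr e \<or> xs ! (?n - 1) = Inr e \<and> xs ! 0 = Inl v"
    unfolding adj_iff by blast
  then have ends: "{xs ! (?n - 1), xs ! 0} = {Inl v, Inr e}" by auto
  have step: "(xs ! i, xs ! Suc i) \<in> adj (T - {(v, e)})" if i: "Suc i < ?n" for i
  proof -
    have "(xs ! i, xs ! Suc i) \<in> adj T" using nth[of i] i by simp
    then obtain v' e' where d': "(v', e') \<in> T"
      "xs ! i = Inl v' \<and> xs ! Suc i = Inr e' \<or> xs ! i = Inr e' \<and> xs ! Suc i = Inl v'"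
      unfolding adj_iff by blast
    \<comment> \<open>Distinct nodes and length at least 3 keep the other cycle edges apart from the
      closing one.\<close>
    have "{xs ! i, xs ! Suc i} \<noteq> {xs ! (?n - 1), xs ! 0}"
    proof
      assume eq: "{xs ! i, xs ! Suc i} = {xs ! (?n - 1), xs ! 0}"
      then have "xs ! (Suc i) = xs ! (?n - 1)"
        using i dist len by (auto simp: doubleton_eq_iff nth_eq_iff_index_eq)
      moreover have "xs ! i = xs ! 0" using eq calculation by (auto simp: doubleton_eq_iff)
      ultimately have "Suc i = ?n - 1" "i = 0"
        using i len nth_eq_iff_index_eq[OF dist, of "Suc i" "?n - 1"]
          nth_eq_iff_index_eq[OF dist, of i 0] by linarith+
      then show False using len by simp
    qed
    then have "(v', e') \<noteq> (v, e)" using d'(2) unfolding ends by auto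
    then show ?thesis using d' unfolding adj_iff by blast
  qed
  have "(xs ! 0, xs ! i) \<in> (adj (T - {(v, e)}))\<^sup>*" if "i < ?n" for i
    using that
  proof (induction i)
    case (Suc i)
    then show ?case using step[of i] by (meson Suc_lessD rtrancl.rtrancl_into_rtrancl)
  qed auto
  then have path: "(xs ! 0, xs ! (?n - 1)) \<in> (adj (T - {(v, e)}))\<^sup>*" using len by simp
  have "\<exists>d\<in>T - {(v, e)}. crosses S d"
    if S: "\<exists>x \<in> V <+> E. x \<in> S" "\<exists>y \<in> V <+> E. y \<notin> S" for S
  proof (cases "crosses S (v, e)")
    case True
    then have "(xs ! 0 \<in> S) \<noteq> (xs ! (?n - 1) \<in> S)"
      using ends unfolding crosses_def by (auto simp: doubleton_eq_iff)
    then show ?thesis using path_crosses[OF path] by blast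
  next
    case False
    then show ?thesis using T S unfolding connected_graph_iff_cut by (metis DiffI singletonD)
  qed
  then have "connected_graph V E (T - {(v, e)})"
    using T unfolding connected_graph_iff_cut by blast
  then show ?thesis using d by blast
qed

text \<open>An acyclic \<open>T\<close> coincides with a connected subgraph \<open>T0\<close> of the
  right size, as any further edge would close a cycle. Conversely, deleting an edge of a cycle would
  leave a connected graph with too few edges. Later arguments count edges and never look at
  cycles.\<close>

lemma spanning_tree_iff_card:
  assumes fin: "finite V" "finite E" and G: "G \<subseteq> V \<times> E"
  shows "spanning_tree V E G T \<longleftrightarrow>
    T \<subseteq> G \<and> connected_graph V E T \<and> card T + 1 = card (V <+> E)"
proof (cases "T \<subseteq> G \<and> connected_graph V E T")
  case True
  then have TVE: "T \<subseteq> V \<times> E" and T: "connected_graph V E T" using G by auto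
  have finT: "finite T" using TVE fin by (meson finite_SigmaI finite_subset)
  have "(\<nexists>xs. cycle T xs) \<longleftrightarrow> card T + 1 = card (V <+> E)"
  proof
    assume acyc: "\<nexists>xs. cycle T xs"
    obtain T0 where T0: "T0 \<subseteq> T" "connected_graph V E T0" "card T0 + 1 = card (V <+> E)"
      using ex_connected_card[OF T TVE fin] by blast
    have "T \<subseteq> T0"
    proof (rule subrelI, rule ccontr)
      fix v e assume ve: "(v, e) \<in> T" "(v, e) \<notin> T0"
      then have "connected_graph V E (T - {(v, e)})"
        using T0(1) by (intro connected_graph_mono[OF T0(2)]) auto
      moreover have "v \<in> V" "e \<in> E" using ve TVE by auto
      ultimately have "(Inl v, Inr e) \<in> (adj (T - {(v, e)}))\<^sup>*"
        unfolding connected_graph_def by blast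
      then show False using cycle_of_path[OF ve(1)] acyc by simp
    qed
    then show "card T + 1 = card (V <+> E)" using T0 by (metis subset_antisym)
  next
    assume c: "card T + 1 = card (V <+> E)"
    show "\<nexists>xs. cycle T xs"
    proof
      assume "\<exists>xs. cycle T xs"
      then obtain d where d: "d \<in> T" "connected_graph V E (T - {d})"
        using cycle_removable[OF _ T] by blast
      then have "card (V <+> E) \<le> card (T - {d}) + 1"
        using finT fin by (intro card_connected) auto
      then show False using d(1) finT c by (metis Suc_eq_plus1 Suc_n_not_le_n card_Suc_Diff1)
    qed
  qed
  then show ?thesis using True unfolding spanning_tree_def by blast
qed (auto simp: spanning_tree_def)

text \<open>\<open>K\<close> is the component of \<open>w\<close> once the edges at
  \<open>\<epsilon>\<close> are deleted. An edge of \<open>R\<close> leaving \<open>K\<close> must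
  be one of these, \<open>(u, \<epsilon>)\<close> with \<open>u\<close> still joined to
  \<open>w\<close>. If \<open>(w, \<epsilon>)\<close> is new, this swap at a single emerald node
  preserves all emerald degrees.\<close>

lemma tree_exchange:
  assumes R: "connected_graph V E R" and w: "w \<in> V" and \<epsilon>: "\<epsilon> \<in> E"
  shows "\<exists>u. (u, \<epsilon>) \<in> R \<and> connected_graph V E (insert (w, \<epsilon>) (R - {(u, \<epsilon>)}))"
proof -
  define R' where "R' = R - incident R (Inr \<epsilon>)"
  define K where "K = {x. (Inl w, x) \<in> (adj R')\<^sup>*}"
  have closed: "\<not> crosses K d" if "d \<in> R'" for d
  proof -
    have "(Inl (fst d), Inr (snd d)) \<in> adj R'" using that unfolding adj_iff by auto
    then show ?thesis using adj_sym unfolding crosses_def K_def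
      by (auto intro: rtrancl_into_rtrancl)
  qed
  have "Inr \<epsilon> \<notin> K"
  proof
    assume "Inr \<epsilon> \<in> K"
    then have "(Inl w, Inr \<epsilon>) \<in> (adj R')\<^sup>*" unfolding K_def by simp
    then obtain d where "d \<in> R'" "crosses {Inr \<epsilon>} d" using path_crosses[of _ _ _ "{Inr \<epsilon>}"] by blast
    then show False unfolding R'_def incident_def crosses_def by auto
  qed
  then obtain g where g: "g \<in> R" "crosses K g"
    using connected_crosses[OF R, of "Inl w" K "Inr \<epsilon>"] w \<epsilon> unfolding K_def by auto
  then have "g \<in> incident R (Inr \<epsilon>)" using closed unfolding R'_def by blast
  then obtain u where gu: "g = (u, \<epsilon>)" unfolding incident_def by auto
  have u: "Inl u \<in> K" using g(2) \<open>Inr \<epsilon> \<notin> K\<close> unfolding gu crosses_def by simp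
  have "\<exists>d\<in>insert (w, \<epsilon>) (R - {(u, \<epsilon>)}). crosses S d"
    if S: "\<exists>x \<in> V <+> E. x \<in> S" "\<exists>y \<in> V <+> E. y \<notin> S" for S
  proof (rule ccontr)
    assume none: "\<not> ?thesis"
    obtain d where "d \<in> R" "crosses S d" using R S unfolding connected_graph_iff_cut by metis
    then have "crosses S (u, \<epsilon>)" using none by blast
    moreover have "\<not> crosses S (w, \<epsilon>)" using none by blast
    ultimately have "(Inl w \<in> S) \<noteq> (Inl u \<in> S)" unfolding crosses_def by auto
    moreover have "(Inl w, Inl u) \<in> (adj R')\<^sup>*" using u unfolding K_def by simp
    ultimately obtain d where "d \<in> R'" "crosses S d" using path_crosses by blast
    moreover have "R' \<subseteq> R - {(u, \<epsilon>)}" unfolding R'_def incident_def by auto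
    ultimately show False using none by blast
  qed
  then have "connected_graph V E (insert (w, \<epsilon>) (R - {(u, \<epsilon>)}))"
    using R unfolding connected_graph_iff_cut by blast
  then show ?thesis using g(1) gu by blast
qed

section \<open>Hypertrees and counting\<close>

text \<open>Counted through the complement: at least \<open>card (V <+> E - U)\<close> edges of the
  tree touch nodes outside \<open>U\<close>, and none of them is in \<open>M\<close>, which leaves
  at most \<open>card U - 1\<close> edges for \<open>M\<close>.\<close>

lemma card_inside_tree:
  assumes fin: "finite V" "finite E" and G: "G \<subseteq> V \<times> E" and R: "spanning_tree V E G R"
    and M: "M \<subseteq> R" "\<And>d. d \<in> M \<Longrightarrow> Inl (fst d) \<in> U \<and> Inr (snd d) \<in> U"
    and U: "U \<subseteq> V <+> E" "U \<noteq> {}"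
  shows "card M + 1 \<le> card U"
proof -
  let ?N = "V <+> E"
  have R': "R \<subseteq> G" "connected_graph V E R" "card R + 1 = card ?N"
    using R spanning_tree_iff_card[OF fin G] by auto
  have finR: "finite R" using R'(1) G fin by (meson finite_SigmaI finite_subset)
  have "card (?N - U) \<le> card {d \<in> R. touches (?N - U) d}"
    using U fin finR R'(2) by (intro card_touching) auto
  moreover have "M \<inter> {d \<in> R. touches (?N - U) d} = {}"
    using M(2) unfolding touches_def by blast
  then have "card M + card {d \<in> R. touches (?N - U) d} \<le> card R"
    using M(1) finR finite_subset
    by (subst card_Un_disjoint[symmetric]) (auto intro!: card_mono)
  moreover have "card (?N - U) + card U = card ?N"
    using U fin by (metis add.commute card_Diff_subset card_mono finite_Plus finite_subset le_add_diff_inverse)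
  ultimately show ?thesis using R'(3) by linarith
qed

text \<open>A realization containing as many edges of \<open>M\<close> as possible contains all of them: a missing
  edge could be exchanged at its emerald endpoint, and the edge given up for it would not be in \<open>M\<close>.\<close>

lemma hypertree_E_superset:
  assumes fin: "finite V" "finite E" and G: "G \<subseteq> V \<times> E" and ht: "hypertree_E V E f G"
    and M: "M \<subseteq> G"
    and uniq: "\<And>d d'. d \<in> M \<Longrightarrow> d' \<in> M \<Longrightarrow> snd d = snd d' \<Longrightarrow>
      hypertree_E V E f (G - {d}) \<Longrightarrow> hypertree_E V E f (G - {d'}) \<Longrightarrow> d = d'"
  shows "\<exists>R. spanning_tree V E G R \<and> M \<subseteq> R"
proof -
  define real where "real R \<longleftrightarrow> spanning_tree V E G R \<and> (\<forall>e\<in>E. degree R (Inr e) = f e + 1)" for R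
  have finG: "finite G" using G fin by (meson finite_SigmaI finite_subset)
  have "\<exists>R. real R" using ht unfolding hypertree_E_def real_def .
  moreover have "\<forall>R. real R \<longrightarrow> card (R \<inter> M) < Suc (card M)"
    using finite_subset[OF M finG] by (simp add: card_mono less_Suc_eq_le)
  ultimately obtain R where R: "real R" and max: "\<And>R'. real R' \<Longrightarrow> card (R' \<inter> M) \<le> card (R \<inter> M)"
    using ex_has_greatest_nat[of real _ "\<lambda>R. card (R \<inter> M)"] by blast
  have RT: "R \<subseteq> G" "connected_graph V E R" "card R + 1 = card (V <+> E)"
    and deg: "\<And>e. e \<in> E \<Longrightarrow> degree R (Inr e) = f e + 1"
    using R spanning_tree_iff_card[OF fin G] unfolding real_def by auto
  have finR: "finite R" using RT(1) finG finite_subset by blast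
  have remov: "hypertree_E V E f (G - {d})" if "real R'" "d \<notin> R'" for R' d
    using that unfolding hypertree_E_def real_def spanning_tree_def by (intro exI[of _ R']) auto
  have "M \<subseteq> R"
  proof (rule subrelI, rule ccontr)
    fix w \<epsilon> assume b: "(w, \<epsilon>) \<in> M" "(w, \<epsilon>) \<notin> R"
    have w: "w \<in> V" "\<epsilon> \<in> E" using b(1) M G by auto
    obtain u where u: "(u, \<epsilon>) \<in> R"
      and con: "connected_graph V E (insert (w, \<epsilon>) (R - {(u, \<epsilon>)}))"
      using tree_exchange[OF RT(2) w] by blast
    let ?R = "insert (w, \<epsilon>) (R - {(u, \<epsilon>)})"
    have inc: "incident ?R (Inr e) = (if e = \<epsilon> then insert (w, \<epsilon>) (incident R (Inr e) - {(u, \<epsilon>)})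
        else incident R (Inr e))" for e
      unfolding incident_def by auto
    have finI: "finite (incident R (Inr e))" for e
      by (rule finite_subset[OF _ finR]) (auto simp: incident_def)
    have mem: "(u, \<epsilon>) \<in> incident R (Inr \<epsilon>)" "(w, \<epsilon>) \<notin> incident R (Inr \<epsilon>)"
      using u b(2) unfolding incident_def by auto
    have "degree ?R (Inr e) = degree R (Inr e)" for e
      using mem finI[of e] unfolding degree_def inc
      by (auto simp: card.insert_remove card_Suc_Diff1 simp del: card_Diff_insert)
    moreover have "card ?R = card R"
      using u b(2) finR by (simp add: card_Suc_Diff1 del: card_Diff_insert)
    moreover have "?R \<subseteq> G" using RT(1) b(1) M by blast
    ultimately have R': "real ?R"
      unfolding real_def spanning_tree_iff_card[OF fin G] using con RT(3) deg by simp
    have "(u, \<epsilon>) \<notin> M"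
    proof
      assume g: "(u, \<epsilon>) \<in> M"
      have "(u, \<epsilon>) \<notin> ?R" using u b(2) by auto
      \<comment> \<open>Each of the realizations \<open>R\<close> and \<open>?R\<close> avoids one
        of the two edges, so both edges are removable and \<open>uniq\<close> applies.\<close>
      then have "(u, \<epsilon>) = (w, \<epsilon>)" using uniq[OF g b(1)] remov[OF R'] remov[OF R b(2)] by simp
      then show False using u b(2) by simp
    qed
    then have "?R \<inter> M = insert (w, \<epsilon>) (R \<inter> M)" using b(1) by blast
    then have "card (?R \<inter> M) = Suc (card (R \<inter> M))" using finR b(2) by simp
    then show False using max[OF R'] by simp
  qed
  then show ?thesis using R unfolding real_def by blast
qed

lemma hypertree_E_connected: "hypertree_E V E f G \<Longrightarrow> connected_graph V E G"
  unfolding hypertree_E_def spanning_tree_def by (elim exE conjE) (rule connected_graph_mono)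

lemma hypertree_V_connected: "hypertree_V V E f G \<Longrightarrow> connected_graph V E G"
  unfolding hypertree_V_def spanning_tree_def by (elim exE conjE) (rule connected_graph_mono)

lemma spanning_tree_mono: "spanning_tree V E G T \<Longrightarrow> G \<subseteq> H \<Longrightarrow> spanning_tree V E H T"
  unfolding spanning_tree_def by blast

lemma connected_incident:
  assumes "connected_graph V E G" "x \<in> V <+> E" "V \<noteq> {}" "E \<noteq> {}"
  shows "incident G x \<noteq> {}"
proof -
  obtain y where y: "y \<in> V <+> E" "y \<noteq> x" using assms(3,4) by (cases x) auto
  obtain d where "d \<in> G" "crosses {x} d"
    using connected_crosses[OF assms(1,2) _ y(1), of "{x}"] y(2) by blast
  then show ?thesis unfolding crosses_def incident_def by (cases d) auto
qed

lemma degree_f_V: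
  assumes "connected_graph V E T" "finite T" "v \<in> V" "E \<noteq> {}"
  shows "degree T (Inl v) = f_V T v + 1"
proof -
  have "incident T (Inl v) \<noteq> {}" using assms by (intro connected_incident) auto
  moreover have "finite (incident T (Inl v))"
    using assms(2) by (rule rev_finite_subset) (auto simp: incident_def)
  ultimately show ?thesis unfolding f_V_def degree_def by (simp add: Suc_leI card_gt_0_iff)
qed

lemma hypertree_V_f_V:
  assumes "spanning_tree V E G T" "finite T" "E \<noteq> {}"
  shows "hypertree_V V E (f_V T) G"
proof -
  have "connected_graph V E T" "spanning_tree V E G T"
    using assms(1) unfolding spanning_tree_def by auto
  then show ?thesis unfolding hypertree_V_def using degree_f_V[OF _ assms(2) _ assms(3)] by blast
qed

lemma card_violet_edges:
  assumes "finite G" "finite S"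
  shows "card {d \<in> G. fst d \<in> S} = (\<Sum>v\<in>S. degree G (Inl v))"
proof -
  have "{d \<in> G. fst d \<in> S} = (\<Union>v\<in>S. incident G (Inl v))"
    unfolding incident_def by auto
  moreover have "finite (incident G (Inl v))" for v
    using assms(1) by (rule rev_finite_subset) (auto simp: incident_def)
  ultimately show ?thesis unfolding degree_def using assms(2)
    by (simp add: card_UN_disjoint incident_def disjoint_iff)
qed

text \<open>Every edge of \<open>T\<close> at a violet node of \<open>S\<close> stays in \<open>S\<close>, so there are fewer than \<open>|S|\<close> of
  them. A spanning tree of \<open>H\<close> has at least \<open>|S|\<close> edges touching \<open>S\<close>, all of them at violet nodes
  of \<open>S\<close>.\<close>

lemma not_hypertree_V_cut:
  assumes fin: "finite V" "finite E" and G: "G \<subseteq> V \<times> E" and T: "spanning_tree V E G T"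
    and H: "H \<subseteq> V \<times> E" and S: "S \<subset> V <+> E" "S \<noteq> {}" and E: "E \<noteq> {}"
    and TS: "\<And>d. d \<in> T \<Longrightarrow> Inl (fst d) \<in> S \<Longrightarrow> Inr (snd d) \<in> S"
    and HS: "\<And>d. d \<in> H \<Longrightarrow> Inr (snd d) \<in> S \<Longrightarrow> Inl (fst d) \<in> S"
  shows "\<not> hypertree_V V E (f_V T) H"
proof
  assume "hypertree_V V E (f_V T) H"
  then obtain T' where T': "spanning_tree V E H T'"
    and deg': "\<And>v. v \<in> V \<Longrightarrow> degree T' (Inl v) = f_V T v + 1"
    unfolding hypertree_V_def by blast
  have conn: "T \<subseteq> G" "T' \<subseteq> H" "connected_graph V E T" "connected_graph V E T'"
    using T T' unfolding spanning_tree_def by auto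
  have finT: "finite T" "finite T'"
    using conn(1,2) G H fin by (meson finite_SigmaI finite_subset)+
  let ?S = "{v \<in> V. Inl v \<in> S}"
  have "card S \<le> card {d \<in> T'. touches S d}"
    using conn(4) finT(2) S(1) fin by (intro card_touching) (auto intro: finite_subset)
  also have "{d \<in> T'. touches S d} = {d \<in> T'. fst d \<in> ?S}"
    using HS conn(2) H unfolding touches_def by auto
  also have "card \<dots> = (\<Sum>v\<in>?S. degree T' (Inl v))" using finT fin by (intro card_violet_edges) auto
  also have "\<dots> = (\<Sum>v\<in>?S. degree T (Inl v))"
    using deg' degree_f_V[OF conn(3) finT(1) _ E] by (intro sum.cong) auto
  also have "\<dots> = card {d \<in> T. fst d \<in> ?S}"
    using finT fin by (intro card_violet_edges[symmetric]) auto
  finally have "card S \<le> card {d \<in> T. fst d \<in> ?S}" .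
  moreover have "card {d \<in> T. fst d \<in> ?S} + 1 \<le> card S"
    using S TS by (intro card_inside_tree[OF fin G T]) auto
  ultimately show False by simp
qed

section \<open>Rotations\<close>

text \<open>Positions \<open>j\<close> and \<open>n\<close> carry the same element, so the segment
  between them is closed under \<open>g\<close> and contains the orbit of its first element, which
  is all of \<open>S\<close>. This serves to recognize a full turn of a rotation.\<close>

lemma cyclic_on_segment:
  assumes cyc: "cyclic_on g S" and s: "s \<in> S" and eq: "(g ^^ j) s = (g ^^ n) s" and jn: "j < n"
  shows "S = {(g ^^ i) s | i. j \<le> i \<and> i < n}" (is "S = ?C")
proof
  have step: "g y \<in> ?C" if y: "y \<in> ?C" for y
  proof -
    obtain i where i: "y = (g ^^ i) s" "j \<le> i" "i < n" using y by blast
    show ?thesis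
    proof (cases "Suc i = n")
      case True
      then have "g y = (g ^^ j) s" using i(1) eq by (metis comp_apply funpow.simps(2))
      then show ?thesis using jn by blast
    next
      case False
      then have "g y = (g ^^ Suc i) s" "j \<le> Suc i" "Suc i < n" using i by auto
      then show ?thesis by blast
    qed
  qed
  have "(g ^^ j) s \<in> S" using cyclic_on_funpow_in[OF cyc s] .
  then have "S = orbit g ((g ^^ j) s)" using cyc unfolding cyclic_on_alldef by blast
  moreover have "y \<in> ?C" if "y \<in> orbit g ((g ^^ j) s)" for y
    using that
  proof (induction rule: orbit.induct)
    case base
    have "(g ^^ j) s \<in> ?C" using jn by blast
    then show ?case by (rule step)
  next
    case (step y)
    then show ?case using \<open>\<And>y. y \<in> ?C \<Longrightarrow> g y \<in> ?C\<close> by blast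
  qed
  ultimately show "S \<subseteq> ?C" by blast
  show "?C \<subseteq> S" using cyclic_on_funpow_in[OF cyc s] by blast
qed

lemma next_edgeE:
  assumes cyc: "cyclic_on (\<rho> x) (incident B x)" and GB: "G \<subseteq> B"
    and c: "c \<in> incident B x" and d: "d \<in> incident G x"
  obtains m where "0 < m" "next_edge \<rho> G x c = (\<rho> x ^^ m) c" "next_edge \<rho> G x c \<in> incident G x"
    "\<And>j. 0 < j \<Longrightarrow> j < m \<Longrightarrow> (\<rho> x ^^ j) c \<notin> G" "d \<noteq> c \<Longrightarrow> next_edge \<rho> G x c \<noteq> c"
proof -
  let ?Q = "\<lambda>n. 0 < n \<and> (\<rho> x ^^ n) c \<in> incident G x"
  define m where "m = (LEAST n. ?Q n)"
  have inc: "incident G x = incident B x \<inter> G" using GB unfolding incident_def by auto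
  have "d \<in> orbit (\<rho> x) c" using cyc c d unfolding cyclic_on_alldef inc by blast
  then obtain n where "?Q n" using d unfolding orbit_altdef by blast
  then have m: "?Q m" unfolding m_def by (rule LeastI)
  have ne: "next_edge \<rho> G x c = (\<rho> x ^^ m) c" unfolding next_edge_def m_def by simp
  have least: "(\<rho> x ^^ j) c \<notin> G" if "0 < j" "j < m" for j
    using not_less_Least[of j ?Q] that cyclic_on_funpow_in[OF cyc c] unfolding m_def inc by blast
  have "next_edge \<rho> G x c \<noteq> c" if "d \<noteq> c"
  proof
    assume "next_edge \<rho> G x c = c"
    \<comment> \<open>Returning to \<open>c\<close> means a full turn, which would have met
      \<open>d\<close> at a position strictly between 0 and \<open>m\<close>.\<close>
    then have "(\<rho> x ^^ 0) c = (\<rho> x ^^ m) c" unfolding ne by simp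
    then obtain i where "i < m" "d = (\<rho> x ^^ i) c"
      using cyclic_on_segment[OF cyc c] m d unfolding inc by blast
    moreover from this have "0 < i" using that by (cases i) auto
    ultimately show False using least d unfolding inc by blast
  qed
  then show thesis using that m ne least by metis
qed

section \<open>The tour as a depth-first search\<close>

fun opposite :: "'v + 'e \<Rightarrow> 'v \<times> 'e \<Rightarrow> 'v + 'e" where
  "opposite (Inl v) d = Inr (snd d)"
| "opposite (Inr e) d = Inl (fst d)"

definition inside :: "('v + 'e) set \<Rightarrow> 'v \<times> 'e \<Rightarrow> bool" where
  "inside S d \<longleftrightarrow> Inl (fst d) \<in> S \<and> Inr (snd d) \<in> S"

definition both_ways :: "(('v + 'e) \<times> ('v \<times> 'e)) set \<Rightarrow> 'v \<times> 'e \<Rightarrow> bool" where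
  "both_ways D d \<longleftrightarrow> (Inl (fst d), d) \<in> D \<and> (Inr (snd d), d) \<in> D"

lemma incident_iff: "d \<in> incident G x \<longleftrightarrow> d \<in> G \<and> (x = Inl (fst d) \<or> x = Inr (snd d))"
  unfolding incident_def by (cases d) auto

lemma incident_opposite: "c \<in> incident G x \<Longrightarrow> c \<in> incident G (opposite x c)"
  unfolding incident_iff by (cases x) auto

lemma opposite_neq: "opposite x c \<noteq> x"
  by (cases x) auto

lemma opposite_iff:
  assumes "c \<in> incident G x"
  shows "c \<in> incident H z \<longleftrightarrow> c \<in> H \<and> (z = x \<or> z = opposite x c)"
    and "inside S c \<longleftrightarrow> x \<in> S \<and> opposite x c \<in> S"
    and "both_ways D c \<longleftrightarrow> (x, c) \<in> D \<and> (opposite x c, c) \<in> D"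
  using assms unfolding incident_iff inside_def both_ways_def by (cases x; auto)+

text \<open>
  The stack holds the path from the current node down to the base node. A frame records a node on
  it, the edge through which the node was entered, the position of its current edge counted from
  there in the rotation, the node together with its finished descendants, and the current graph
  at the moment of entry. The base node gets the predecessor of its first edge as \<open>entry\<close>.
\<close>

datatype ('v, 'e) frame = Frame (node: "'v + 'e") (entry: "'v \<times> 'e") (rank: nat)
  (block: "('v + 'e) set") (graph: "('v, 'e) bigraph")

definition visited :: "('v, 'e) frame list \<Rightarrow> ('v + 'e) set" where
  "visited st = \<Union>(block ` set st)"

lemma visited_simps [simp]:
  "visited [] = {}" "visited (fr # st) = block fr \<union> visited st"
  unfolding visited_def by auto

section \<open>The invariant of the search\<close>

locale ribbon_hypergraph =
  fixes V :: "'v set" and E :: "'e set" and A :: "'e \<Rightarrow> 'v set"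
    and \<rho> :: "'v + 'e \<Rightarrow> 'v \<times> 'e \<Rightarrow> 'v \<times> 'e" and f :: "'e \<Rightarrow> nat"
  assumes hypergraph: "hypergraph V E A"
    and ribbon: "ribbon_structure V E (Bip V E A) \<rho>"
    and nonempty: "V \<noteq> {}" "E \<noteq> {}"
begin

abbreviation "B \<equiv> Bip V E A"
abbreviation "P \<equiv> hypertree_E V E f"

lemma fin: "finite V" "finite E"
  using hypergraph unfolding hypergraph_def by auto

lemma Bip_subset: "B \<subseteq> V \<times> E"
  unfolding Bip_def by auto

lemma subset_Bip: "G \<subseteq> B \<Longrightarrow> G \<subseteq> V \<times> E"
  using Bip_subset by blast

lemma finite_subgraph: "G \<subseteq> B \<Longrightarrow> finite G"
  using Bip_subset fin by (meson finite_SigmaI finite_subset)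

lemma cyclic: "x \<in> V <+> E \<Longrightarrow> cyclic_on (\<rho> x) (incident B x)"
  using ribbon unfolding ribbon_structure_def by blast

lemma incident_node: "d \<in> incident B x \<Longrightarrow> x \<in> V <+> E"
  unfolding incident_iff Bip_def by auto

definition pointer :: "('v, 'e) frame \<Rightarrow> 'v \<times> 'e" where
  "pointer fr = (\<rho> (node fr) ^^ rank fr) (entry fr)"

text \<open>Position 0 is left out because the entry edge comes last at its node. Edges removed in
  the meantime still count as passed.\<close>

definition passed :: "('v, 'e) frame \<Rightarrow> ('v \<times> 'e) set" where
  "passed fr = {(\<rho> (node fr) ^^ j) (entry fr) | j. 1 \<le> j \<and> j < rank fr}"

definition linked where
  "linked G D fr fr' \<longleftrightarrow> entry fr = pointer fr' \<and> node fr = opposite (node fr') (entry fr) \<and>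
     entry fr \<in> incident G (node fr') \<and> (node fr', entry fr) \<in> D \<and> (node fr, entry fr) \<notin> D"

text \<open>The clauses on \<open>both_ways\<close> and \<open>inside\<close> describe the finished
  part of the search below the node. The last clause is there for the comparison of the processes:
  once the block is finished, it controls the edges of \<open>graph fr\<close> at the emerald nodes
  of the block.\<close>

definition frame_ok where
  "frame_ok G D W X fr \<longleftrightarrow>
     node fr \<in> block fr \<and> entry fr \<in> incident B (node fr) \<and> 1 \<le> rank fr \<and> graph fr \<subseteq> B \<and>
     (\<forall>d\<in>passed fr. d \<in> G \<longrightarrow> both_ways D d \<and> inside (block fr) d) \<and>
     (\<forall>d\<in>G. \<forall>z\<in>block fr - {node fr}. d \<in> incident G z \<longrightarrow> both_ways D d \<and> inside (block fr) d) \<and>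
     snd ` D \<inter> incident B (node fr) \<subseteq> passed fr \<union> X \<and>
     (\<forall>d\<in>graph fr - G. Inl (fst d) \<in> W \<union> block fr)"

text \<open>\<open>W\<close> collects the blocks above a frame, and \<open>X\<close> contains the edge to the next frame above.\<close>

fun stack_ok where
  "stack_ok G D W X [] = True"
| "stack_ok G D W X (fr # st) \<longleftrightarrow>
     frame_ok G D W (X \<union> (if st = [] then {} else {entry fr})) fr \<and>
     (st \<noteq> [] \<longrightarrow> linked G D fr (hd st)) \<and> block fr \<inter> visited st = {} \<and>
     stack_ok G D (W \<union> block fr) {entry fr} st"

text \<open>The cardinality equation stands in for the fact that the traversed edges form a tree on
  the visited nodes; it is what rules out closing a cycle. The clause on \<open>G - {d}\<close>
  records that an edge traversed from its violet end is indispensable.\<close>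

definition state_ok where
  "state_ok G D st \<longleftrightarrow> st \<noteq> [] \<and> stack_ok G D {} {} st \<and> G \<subseteq> B \<and> P G \<and>
     D \<subseteq> {(x, d). d \<in> incident G x} \<and> (\<forall>d. (Inl (fst d), d) \<in> D \<longrightarrow> \<not> P (G - {d})) \<and>
     visited st \<subseteq> V <+> E \<and> card (visited st) = card (snd ` D) + 1 \<and>
     (\<forall>d\<in>snd ` D. inside (visited st) d) \<and> pointer (hd st) \<in> incident G (node (hd st))"

lemma frame_okD:
  assumes "frame_ok G D W X fr"
  shows "node fr \<in> block fr" and "entry fr \<in> incident B (node fr)" and "1 \<le> rank fr"
    and "graph fr \<subseteq> B"
    and "\<And>d. d \<in> passed fr \<Longrightarrow> d \<in> G \<Longrightarrow> both_ways D d \<and> inside (block fr) d"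
    and "\<And>d z. z \<in> block fr \<Longrightarrow> z \<noteq> node fr \<Longrightarrow> d \<in> incident G z \<Longrightarrow>
      both_ways D d \<and> inside (block fr) d"
    and "snd ` D \<inter> incident B (node fr) \<subseteq> passed fr \<union> X"
    and "\<And>d. d \<in> graph fr \<Longrightarrow> d \<notin> G \<Longrightarrow> Inl (fst d) \<in> W \<union> block fr"
  using assms unfolding frame_ok_def incident_iff by auto

lemma frame_ok_mono:
  assumes "frame_ok G D W X fr" and "G' \<subseteq> G" "D \<subseteq> D'" "W \<subseteq> W'" "X \<subseteq> X'"
    and "\<And>d. d \<in> G - G' \<Longrightarrow> Inl (fst d) \<in> W' \<union> block fr"
    and "snd ` D' \<inter> incident B (node fr) \<subseteq> snd ` D \<union> X'"
  shows "frame_ok G' D' W' X' fr"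
proof -
  note ok = frame_okD[OF assms(1)]
  have both: "both_ways D' d" if "both_ways D d" for d
    using that assms(3) unfolding both_ways_def by blast
  have inc: "d \<in> incident G z" if "d \<in> incident G' z" for d z
    using that assms(2) unfolding incident_iff by blast
  show ?thesis unfolding frame_ok_def
  proof (intro conjI ballI impI)
    fix d assume "d \<in> passed fr" "d \<in> G'"
    then show "both_ways D' d" "inside (block fr) d" using ok(5) both assms(2) by blast+
  next
    fix d z assume "z \<in> block fr - {node fr}" "d \<in> incident G' z"
    then show "both_ways D' d" "inside (block fr) d" using ok(6)[of z d] both inc by blast+
  next
    show "snd ` D' \<inter> incident B (node fr) \<subseteq> passed fr \<union> X'" using ok(7) assms(5,7) by blast
  next
    fix d assume "d \<in> graph fr - G'"
    then show "Inl (fst d) \<in> W' \<union> block fr" using ok(8)[of d] assms(4) assms(6)[of d] by blast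
  qed (use ok in simp_all)
qed

text \<open>Carries the lower frames through a move at the top: removed edges have their violet end
  in the blocks above, and new traversals neither start at a lower stack node nor bring a new
  traversed edge to one.\<close>

lemma stack_ok_mono:
  assumes "stack_ok G D W X st" and "G' \<subseteq> G" "D \<subseteq> D'" "W \<subseteq> W'" "X \<subseteq> X'"
    and "\<And>d. d \<in> G - G' \<Longrightarrow> Inl (fst d) \<in> W'" and "snd ` D \<subseteq> G'"
    and "\<And>y d fr. (y, d) \<in> D' - D \<Longrightarrow> fr \<in> set st \<Longrightarrow>
      y \<noteq> node fr \<and> (d \<in> snd ` D \<or> d \<notin> incident B (node fr))"
  shows "stack_ok G' D' W' X' st"
  using assms(1,4,5,6,8)
proof (induction st arbitrary: W X W' X')
  case (Cons fr st)
  have fr: "frame_ok G D W (X \<union> (if st = [] then {} else {entry fr})) fr"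
    and link: "st \<noteq> [] \<Longrightarrow> linked G D fr (hd st)" and disj: "block fr \<inter> visited st = {}"
    and st: "stack_ok G D (W \<union> block fr) {entry fr} st"
    using Cons.prems(1) by auto
  have "frame_ok G' D' W' (X' \<union> (if st = [] then {} else {entry fr})) fr"
  proof (rule frame_ok_mono[OF fr assms(2,3) Cons.prems(2)])
    show "X \<union> (if st = [] then {} else {entry fr}) \<subseteq> X' \<union> (if st = [] then {} else {entry fr})"
      using Cons.prems(3) by auto
    show "Inl (fst d) \<in> W' \<union> block fr" if "d \<in> G - G'" for d
      using Cons.prems(4)[OF that] by blast
    show "snd ` D' \<inter> incident B (node fr) \<subseteq> snd ` D \<union> (X' \<union> (if st = [] then {} else {entry fr}))"
      using Cons.prems(5) by fastforce
  qed
  moreover have "linked G' D' fr (hd st)" if "st \<noteq> []"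
  proof -
    have "entry fr \<in> G'" using link[OF that] assms(7) unfolding linked_def by force
    moreover have "(node fr, entry fr) \<notin> D' - D" using Cons.prems(5)[of "node fr" "entry fr" fr] by auto
    ultimately show ?thesis using link[OF that] assms(3) unfolding linked_def incident_iff by auto
  qed
  moreover have "stack_ok G' D' (W' \<union> block fr) {entry fr} st"
    using Cons.prems by (intro Cons.IH[OF st]) auto
  ultimately show ?case using disj by simp
qed auto

lemma node_in_visited: "stack_ok G D W X st \<Longrightarrow> fr \<in> set st \<Longrightarrow> node fr \<in> visited st"
  by (induction st arbitrary: W X) (auto simp: frame_ok_def)

text \<open>An emerald node has at most one edge that has been traversed only from it, because its
  earlier ones have also been traversed back.\<close>

lemma open_edges:
  assumes "stack_ok G D W X st" and D: "D \<subseteq> {(x, d). d \<in> incident G x}" and GB: "G \<subseteq> B"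
    and "Inr \<epsilon> \<in> visited st"
  defines "Op \<equiv> {d \<in> snd ` D. snd d = \<epsilon> \<and> (Inl (fst d), d) \<notin> D}"
  shows "(node (hd st) = Inr \<epsilon> \<longrightarrow> Op \<subseteq> X) \<and> (\<exists>y. node (hd st) \<noteq> Inr \<epsilon> \<longrightarrow> Op \<subseteq> {y})"
  using assms(1,4)
proof (induction st arbitrary: W X)
  case (Cons fr st)
  have fr: "frame_ok G D W (X \<union> (if st = [] then {} else {entry fr})) fr"
    and link: "st \<noteq> [] \<Longrightarrow> linked G D fr (hd st)" and disj: "block fr \<inter> visited st = {}"
    and st: "stack_ok G D (W \<union> block fr) {entry fr} st"
    using Cons.prems(1) by auto
  have OpG: "d \<in> G" "d \<in> incident G (Inr \<epsilon>)" "\<not> both_ways D d" if "d \<in> Op" for d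
    using that D unfolding Op_def both_ways_def incident_iff by auto
  show ?case
  proof (cases "Inr \<epsilon> \<in> block fr")
    case True
    show ?thesis
    proof (cases "node fr = Inr \<epsilon>")
      case n: True
      have "d \<in> X" if d: "d \<in> Op" for d
      proof -
        have "d \<in> incident B (node fr)" using OpG(2)[OF d] GB n unfolding incident_iff by auto
        then have "d \<in> passed fr \<union> (X \<union> (if st = [] then {} else {entry fr}))"
          using frame_okD(7)[OF fr] d unfolding Op_def by blast
        moreover have "d \<notin> passed fr" using frame_okD(5)[OF fr] OpG[OF d] by blast
        \<comment> \<open>An emerald node is entered by a traversal from the violet end, so its
          entry edge is not in \<open>Op\<close>.\<close>
        moreover have "d \<noteq> entry fr" if "st \<noteq> []"
        proof
          assume e: "d = entry fr"
          have l: "linked G D fr (hd st)" using link[OF that] .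
          have "node (hd st) = Inl (fst d)"
            using l n e unfolding linked_def incident_iff by (cases "node (hd st)") auto
          then show False using l e d unfolding linked_def Op_def by auto
        qed
        ultimately show ?thesis by (auto split: if_splits)
      qed
      then show ?thesis using n by auto
    next
      case False
      \<comment> \<open>At a finished descendant every remaining edge has been traversed both
        ways.\<close>
      have "d \<notin> Op" for d using OpG[of d] frame_okD(6)[OF fr True, of d] False by auto
      then have "Op = {}" by blast
      then show ?thesis using False by simp
    qed
  next
    case False
    then have v: "Inr \<epsilon> \<in> visited st" using Cons.prems(2) by simp
    have "node fr \<noteq> Inr \<epsilon>" using False fr unfolding frame_ok_def by auto
    moreover have "\<exists>y. Op \<subseteq> {y}" using Cons.IH[OF st v] by blast
    ultimately show ?thesis by simp
  qed
qed auto

text \<open>The skipped positions carry edges absent from \<open>G\<close>, so within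
  \<open>G\<close> the only newly passed edge is the former current one.\<close>

lemma passed_advance:
  assumes "node fr' = node fr" "entry fr' = entry fr" "rank fr' = rank fr + m"
    and gap: "\<And>j. 0 < j \<Longrightarrow> j < m \<Longrightarrow> (\<rho> (node fr) ^^ j) (pointer fr) \<notin> G"
    and m: "0 < m" and "1 \<le> rank fr"
  shows "pointer fr' = (\<rho> (node fr) ^^ m) (pointer fr)"
    and "passed fr' \<inter> G \<subseteq> insert (pointer fr) (passed fr)"
    and "insert (pointer fr) (passed fr) \<subseteq> passed fr'"
proof -
  let ?g = "\<lambda>j. (\<rho> (node fr) ^^ j) (entry fr)"
  have shift: "?g (rank fr + j) = (\<rho> (node fr) ^^ j) (pointer fr)" for j
    unfolding pointer_def by (metis add.commute comp_apply funpow_add)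
  show "pointer fr' = (\<rho> (node fr) ^^ m) (pointer fr)"
    using shift[of m] assms(1-3) unfolding pointer_def by simp
  show "passed fr' \<inter> G \<subseteq> insert (pointer fr) (passed fr)"
  proof
    fix d assume d: "d \<in> passed fr' \<inter> G"
    then obtain j where j: "d = ?g j" "1 \<le> j" "j < rank fr + m"
      using assms(1-3) unfolding passed_def by auto
    consider "j < rank fr" | "j = rank fr" | "rank fr < j" by linarith
    then show "d \<in> insert (pointer fr) (passed fr)"
    proof cases
      case 3
      then obtain i where i: "j = rank fr + i" "0 < i" by (metis less_imp_add_positive)
      then have "d \<notin> G" using gap[of i] j shift[of i] by simp
      then show ?thesis using d by blast
    qed (use j in \<open>auto simp: passed_def pointer_def\<close>)
  qed
  show "insert (pointer fr) (passed fr) \<subseteq> passed fr'"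
    using m assms(1-3,6) unfolding passed_def pointer_def by fastforce
qed

lemma state_okD:
  assumes "state_ok G D (fr # r)"
  shows "frame_ok G D {} (if r = [] then {} else {entry fr}) fr"
    and "r \<noteq> [] \<Longrightarrow> linked G D fr (hd r)" and "block fr \<inter> visited r = {}"
    and "stack_ok G D (block fr) {entry fr} r" and "G \<subseteq> B" and "P G"
    and "D \<subseteq> {(x, d). d \<in> incident G x}" and "\<And>d. (Inl (fst d), d) \<in> D \<Longrightarrow> \<not> P (G - {d})"
    and "visited (fr # r) \<subseteq> V <+> E" and "card (visited (fr # r)) = card (snd ` D) + 1"
    and "\<And>d. d \<in> snd ` D \<Longrightarrow> inside (visited (fr # r)) d" and "pointer fr \<in> incident G (node fr)"
    and "snd ` D \<subseteq> G" and "finite (snd ` D)" and "finite (visited (fr # r))"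
proof -
  note ok = assms[unfolded state_ok_def]
  show "frame_ok G D {} (if r = [] then {} else {entry fr}) fr"
    "r \<noteq> [] \<Longrightarrow> linked G D fr (hd r)" "block fr \<inter> visited r = {}"
    "stack_ok G D (block fr) {entry fr} r" "G \<subseteq> B" "P G"
    "D \<subseteq> {(x, d). d \<in> incident G x}" "\<And>d. (Inl (fst d), d) \<in> D \<Longrightarrow> \<not> P (G - {d})"
    "visited (fr # r) \<subseteq> V <+> E" "card (visited (fr # r)) = card (snd ` D) + 1"
    "\<And>d. d \<in> snd ` D \<Longrightarrow> inside (visited (fr # r)) d" "pointer fr \<in> incident G (node fr)"
    using ok by auto
  show D: "snd ` D \<subseteq> G" using ok unfolding incident_iff by auto
  show "finite (snd ` D)" using finite_subset[OF D] finite_subgraph[of G] ok by simp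
  show "finite (visited (fr # r))" using ok fin by (auto intro: finite_subset[of _ "V <+> E"])
qed

text \<open>Otherwise the traversed edges together with the current one would lie on the visited
  nodes and be as many as these nodes, while \<open>hypertree_E_superset\<close> places them all in
  one spanning tree.\<close>

lemma unvisited_opposite:
  assumes ok: "state_ok G D (fr # r)" and c: "pointer fr \<notin> snd ` D"
    and mand: "\<And>v. node fr = Inl v \<Longrightarrow> \<not> P (G - {pointer fr})"
  shows "opposite (node fr) (pointer fr) \<notin> visited (fr # r)"
proof
  assume y: "opposite (node fr) (pointer fr) \<in> visited (fr # r)"
  note ok' = state_okD[OF ok]
  let ?c = "pointer fr" and ?U = "visited (fr # r)"
  have stack: "stack_ok G D {} {} (fr # r)" using ok unfolding state_ok_def by blast
  have x: "node fr \<in> ?U" using node_in_visited[OF stack] by simp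
  have open_: "(Inl (fst d), d) \<notin> D" if "P (G - {d})" for d using ok'(8) that by blast
  \<comment> \<open>The exchange argument allows one removable edge per emerald node. Removable
    traversed edges are open, and \<open>open_edges\<close> admits one of them, or none at the top
    node. The current edge can be removable only if the top node is emerald.\<close>
  have "d = d'" if d: "d \<in> snd ` D" "d' \<in> insert ?c (snd ` D)" "snd d = snd d'"
    "P (G - {d})" "P (G - {d'})" for d d'
  proof -
    let ?Op = "{d' \<in> snd ` D. snd d' = snd d \<and> (Inl (fst d'), d') \<notin> D}"
    have vis: "Inr (snd d) \<in> visited (fr # r)" using ok'(11)[OF d(1)] unfolding inside_def by blast
    have op: "node fr = Inr (snd d) \<Longrightarrow> ?Op \<subseteq> {}" "\<exists>y. node fr \<noteq> Inr (snd d) \<longrightarrow> ?Op \<subseteq> {y}"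
      using open_edges[OF stack ok'(7,5) vis] by (simp_all del: subset_empty)
    have dOp: "d \<in> ?Op" using d(1) open_[OF d(4)] by simp
    show ?thesis
    proof (cases "d' = ?c")
      case True
      obtain e where e: "node fr = Inr e" using mand d(5) True by (cases "node fr") auto
      then have "e = snd d" using ok'(12) d(3) True unfolding incident_iff by auto
      then show ?thesis using op(1) e dOp by blast
    next
      case False
      then have "d' \<in> ?Op" using d open_[OF d(5)] by auto
      then show ?thesis using op dOp by blast
    qed
  qed
  then have uniq: "d = d'" if "d \<in> insert ?c (snd ` D)" "d' \<in> insert ?c (snd ` D)" "snd d = snd d'"
    "P (G - {d})" "P (G - {d'})" for d d'
    using that by (metis insertE)
  have "insert ?c (snd ` D) \<subseteq> G" using ok'(12,13) unfolding incident_iff by blast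
  then obtain R where R: "spanning_tree V E G R" "insert ?c (snd ` D) \<subseteq> R"
    using hypertree_E_superset[OF fin subset_Bip[OF ok'(5)] ok'(6) _ uniq] by blast
  have "inside ?U d" if "d \<in> insert ?c (snd ` D)" for d
    using that ok'(11) opposite_iff(2)[OF ok'(12)] x y by blast
  then have "card (insert ?c (snd ` D)) + 1 \<le> card ?U"
    using x ok'(9) unfolding inside_def
    by (intro card_inside_tree[OF fin subset_Bip[OF ok'(5)] R]) auto
  then show False using c ok'(10,14) by simp
qed


section \<open>The moves of the search\<close>

lemma next_edge_in_subgraphE:
  assumes "G \<subseteq> B" and "c \<in> incident B x" and "d \<in> incident G x"
  obtains m where "0 < m" "next_edge \<rho> G x c = (\<rho> x ^^ m) c" "next_edge \<rho> G x c \<in> incident G x"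
    "\<And>j. 0 < j \<Longrightarrow> j < m \<Longrightarrow> (\<rho> x ^^ j) c \<notin> G" "d \<noteq> c \<Longrightarrow> next_edge \<rho> G x c \<noteq> c"
  by (rule next_edgeE[where \<rho> = \<rho> and x = x and B = B, OF cyclic[OF incident_node] assms(1) _ assms(3)])
    (use assms(2) in auto)

text \<open>An edge not yet traversed from either end leads to a new node by
  \<open>unvisited_opposite\<close>, so visited nodes and traversed edges both grow by one.\<close>

lemma state_push:
  assumes ok: "state_ok G D (fr # r)" and c: "pointer fr \<notin> snd ` D"
    and mand: "\<And>v. node fr = Inl v \<Longrightarrow> \<not> P (G - {pointer fr})"
  defines "y \<equiv> opposite (node fr) (pointer fr)"
  shows "\<exists>m. state_ok G (insert (node fr, pointer fr) D) (Frame y (pointer fr) m {y} G # fr # r) \<and>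
    pointer (Frame y (pointer fr) m {y} G) = next_edge \<rho> G y (pointer fr)"
proof -
  note ok' = state_okD[OF ok]
  let ?c = "pointer fr" and ?x = "node fr"
  let ?D = "insert (?x, ?c) D"
  have yc: "?c \<in> incident G y" using incident_opposite ok'(12) unfolding y_def by blast
  then have ycB: "?c \<in> incident B y" using ok'(5) unfolding incident_iff by blast
  obtain m where m: "0 < m" "next_edge \<rho> G y ?c = (\<rho> y ^^ m) ?c" "next_edge \<rho> G y ?c \<in> incident G y"
    and gap: "\<And>j. 0 < j \<Longrightarrow> j < m \<Longrightarrow> (\<rho> y ^^ j) ?c \<notin> G"
    by (rule next_edge_in_subgraphE[OF ok'(5) ycB yc]) (rule that; assumption)
  define F where "F = Frame y ?c m {y} G"
  have F: "node F = y" "entry F = ?c" "rank F = m" "block F = {y}" "graph F = G"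
    unfolding F_def by simp_all
  have yU: "y \<notin> visited (fr # r)" unfolding y_def
    by (rule unvisited_opposite[OF ok c]) (rule mand)
  have sD: "snd ` ?D = insert ?c (snd ` D)" by simp
  have no_y: "d \<notin> incident B y" if "d \<in> snd ` D" for d
    using ok'(11)[OF that] yU unfolding inside_def incident_iff by auto
  have xU: "?x \<in> block fr" using frame_okD(1)[OF ok'(1)] .
  have ends: "?c \<in> incident H z \<longleftrightarrow> ?c \<in> H \<and> (z = ?x \<or> z = y)" for H z
    using opposite_iff(1)[OF ok'(12)] unfolding y_def .
  have f1: "frame_ok G ?D {} {?c} F" unfolding frame_ok_def
  proof (intro conjI)
    show "\<forall>d\<in>passed F. d \<in> G \<longrightarrow> both_ways ?D d \<and> inside (block F) d"
      using gap unfolding passed_def F by fastforce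
    show "snd ` ?D \<inter> incident B (node F) \<subseteq> passed F \<union> {?c}" using no_y unfolding sD F by blast
  qed (use m(1) ycB ok'(5) in \<open>auto simp: F\<close>)
  have "(y, ?c) \<notin> D" using c by force
  then have f2: "linked G ?D F fr" unfolding linked_def F
    using ok'(12) opposite_neq[of ?x ?c] by (auto simp: y_def)
  have f3: "frame_ok G ?D {y} ({?c} \<union> (if r = [] then {} else {entry fr})) fr"
    by (rule frame_ok_mono[OF ok'(1)]) auto
  have "entry fr \<noteq> ?c" if "r \<noteq> []"
    using ok'(2)[OF that] c unfolding linked_def by force
  then have f4: "linked G ?D fr (hd r)" if "r \<noteq> []"
    using ok'(2)[OF that] that unfolding linked_def by auto
  have "?x \<noteq> node g \<and> ?c \<notin> incident B (node g)" if "g \<in> set r" for g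
  proof -
    have "node g \<in> visited r" using node_in_visited[OF ok'(4) that] .
    then have "node g \<noteq> ?x" "node g \<noteq> y" using xU ok'(3) yU by auto
    then show ?thesis using ends[of B "node g"] by simp
  qed
  then have f5: "stack_ok G ?D ({y} \<union> block fr) {entry fr} r"
    using ok'(13) by (intro stack_ok_mono[OF ok'(4)]) auto
  have stack: "stack_ok G ?D {} {} (F # fr # r)"
    using f1 f2 f3 f4 f5 ok'(3) yU by (simp add: F)
  have "state_ok G ?D (F # fr # r)" unfolding state_ok_def
  proof (intro conjI)
    show "stack_ok G ?D {} {} (F # fr # r)" by (rule stack)
    show "?D \<subseteq> {(x, d). d \<in> incident G x}" using ok'(7,12) by blast
    show "\<forall>d. (Inl (fst d), d) \<in> ?D \<longrightarrow> \<not> P (G - {d})"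
    proof (intro allI impI)
      show "\<not> P (G - {d})" if "(Inl (fst d), d) \<in> ?D" for d
        using that ok'(8)[of d] mand[of "fst d"] by auto
    qed
    show "visited (F # fr # r) \<subseteq> V <+> E"
      using ok'(9) incident_node[OF ycB] by (simp add: F)
    show "card (visited (F # fr # r)) = card (snd ` ?D) + 1"
      using ok'(10,14,15) yU c by (simp add: F)
    show "\<forall>d\<in>snd ` ?D. inside (visited (F # fr # r)) d"
    proof
      fix d assume d: "d \<in> snd ` ?D"
      show "inside (visited (F # fr # r)) d"
      proof (cases "d = ?c")
        case True
        then show ?thesis using opposite_iff(2)[OF ok'(12)] xU by (simp add: F y_def)
      next
        case False
        then show ?thesis using ok'(11)[of d] d unfolding inside_def by auto
      qed
    qed
    show "pointer (hd (F # fr # r)) \<in> incident G (node (hd (F # fr # r)))"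
      using m(2,3) by (simp add: F pointer_def)
  qed (use ok'(5,6) in auto)
  moreover have "pointer F = next_edge \<rho> G y ?c" using m(2) by (simp add: F pointer_def)
  ultimately show ?thesis unfolding F_def by blast
qed

text \<open>\<open>pointer fr = entry fr\<close> means that the rotation at the node has come full circle.\<close>

lemma block_finished:
  assumes ok: "state_ok G D (fr # r)" and e: "pointer fr = entry fr" and z: "z \<in> block fr"
    and d: "d \<in> incident G z" "d \<noteq> entry fr"
  shows "both_ways D d \<and> inside (block fr) d"
proof (cases "z = node fr")
  case True
  note ok' = state_okD[OF ok]
  note fr = frame_okD[OF ok'(1)]
  have "(\<rho> (node fr) ^^ 0) (entry fr) = (\<rho> (node fr) ^^ rank fr) (entry fr)"
    using e unfolding pointer_def by simp
  moreover have "d \<in> incident B (node fr)" using d(1) True ok'(5) unfolding incident_iff by auto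
  ultimately obtain i where i: "i < rank fr" "d = (\<rho> (node fr) ^^ i) (entry fr)"
    using cyclic_on_segment[OF cyclic[OF incident_node[OF fr(2)]] fr(2), of 0 "rank fr"] fr(3)
    by auto
  then have "1 \<le> i" using d(2) by (cases i) auto
  then have "d \<in> passed fr" using i unfolding passed_def by blast
  then show ?thesis using fr(5) d(1) unfolding incident_iff by blast
next
  case False
  then show ?thesis using frame_okD(6)[OF state_okD(1)[OF ok] z] d by blast
qed

lemma entry_crosses:
  assumes ok: "state_ok G D (fr # r)" and r: "r \<noteq> []"
  shows "node (hd r) \<notin> block fr" and "node (hd r) \<in> V <+> E"
    and "entry fr \<in> incident G (node (hd r))" and "entry fr \<in> incident G (node fr)"
    and "opposite (node fr) (entry fr) = node (hd r)"
proof -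
  note ok' = state_okD[OF ok]
  have l: "linked G D fr (hd r)" using ok'(2)[OF r] .
  show "node (hd r) \<notin> block fr" using node_in_visited[OF ok'(4), of "hd r"] r ok'(3) by auto
  show i: "entry fr \<in> incident G (node (hd r))" using l unfolding linked_def by blast
  then show "entry fr \<in> incident G (node fr)" using l incident_opposite unfolding linked_def by metis
  show "node (hd r) \<in> V <+> E" using i ok'(5) incident_node unfolding incident_iff by blast
  show "opposite (node fr) (entry fr) = node (hd r)"
    using l i unfolding linked_def incident_iff by (cases "node (hd r)") auto
qed

text \<open>All other edges of \<open>G\<close> at nodes of a finished block stay inside the
  block.\<close>

lemma entry_bridge:
  assumes ok: "state_ok G D (fr # r)" and r: "r \<noteq> []" and e: "pointer fr = entry fr"
  shows "\<not> connected_graph V E (G - {entry fr})"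
proof
  note ok' = state_okD[OF ok]
  assume con: "connected_graph V E (G - {entry fr})"
  have x: "node fr \<in> block fr" "node fr \<in> V <+> E"
    using frame_okD(1,2)[OF ok'(1)] incident_node by blast+
  obtain d where d: "d \<in> G - {entry fr}" "crosses (block fr) d"
    using connected_crosses[OF con x(2,1) entry_crosses(2,1)[OF ok r]] .
  obtain z where "z \<in> block fr" "d \<in> incident G z"
    using d unfolding crosses_def incident_iff by blast
  then have "inside (block fr) d" using block_finished[OF ok e] d(1) by blast
  then show False using d(2) unfolding inside_def crosses_def by blast
qed

text \<open>The entry edge is traversed back and the finished block is absorbed by the frame below,
  whose pointer sits at that same edge and moves on. The visited nodes and the edges traversed in
  some direction stay the same.\<close>

lemma state_pop:
  assumes ok: "state_ok G D (fr # fr' # r)" and e: "pointer fr = entry fr"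
    and mand: "\<And>v. node fr = Inl v \<Longrightarrow> \<not> P (G - {entry fr})"
  shows "\<exists>n. state_ok G (insert (node fr, entry fr) D)
      (Frame (node fr') (entry fr') n (block fr \<union> block fr') (graph fr') # r) \<and>
    pointer (Frame (node fr') (entry fr') n (block fr \<union> block fr') (graph fr')) =
      next_edge \<rho> G (node fr') (entry fr)"
proof -
  note ok' = state_okD[OF ok]
  let ?c = "entry fr" and ?x = "node fr" and ?y = "node fr'"
  let ?D = "insert (?x, ?c) D"
  note ent = entry_crosses[OF ok, simplified]
  have fr'_ok: "frame_ok G D (block fr) (insert ?c (if r = [] then {} else {entry fr'})) fr'"
    and link': "r \<noteq> [] \<Longrightarrow> linked G D fr' (hd r)" and disj': "block fr' \<inter> visited r = {}"
    and r_ok: "stack_ok G D (block fr \<union> block fr') {entry fr'} r"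
    using ok'(4) by auto
  have link: "linked G D fr fr'" using ok'(2) by simp
  then have c: "?c = pointer fr'" "(?y, ?c) \<in> D" unfolding linked_def by auto
  then have sD: "snd ` ?D = snd ` D" by force
  note fr' = frame_okD[OF fr'_ok]
  have ycB: "?c \<in> incident B ?y" using ent(3) ok'(5) unfolding incident_iff by blast
  obtain m where m: "0 < m" "next_edge \<rho> G ?y ?c = (\<rho> ?y ^^ m) ?c"
    "next_edge \<rho> G ?y ?c \<in> incident G ?y"
    and gap: "\<And>j. 0 < j \<Longrightarrow> j < m \<Longrightarrow> (\<rho> ?y ^^ j) ?c \<notin> G"
    by (rule next_edge_in_subgraphE[OF ok'(5) ycB ent(3)]) (rule that; assumption)
  define F where "F = Frame ?y (entry fr') (rank fr' + m) (block fr \<union> block fr') (graph fr')"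
  have F: "node F = ?y" "entry F = entry fr'" "rank F = rank fr' + m"
    "block F = block fr \<union> block fr'" "graph F = graph fr'"
    unfolding F_def by simp_all
  note adv = passed_advance[OF F(1-3) gap[unfolded c(1)] m(1) fr'(3), folded c(1)]
  have both_c: "both_ways ?D ?c" using opposite_iff(3)[OF ent(4)] ent(5) c(2) by auto
  have both: "both_ways ?D d" if "both_ways D d" for d
    using that unfolding both_ways_def by blast
  have x: "?x \<in> block fr" using frame_okD(1)[OF ok'(1)] .
  have inside_c: "inside (block F) ?c"
    using opposite_iff(2)[OF ent(4)] ent(5) x fr'(1) by (simp add: F)
  have inside_F: "inside (block F) d" if "inside (block fr) d \<or> inside (block fr') d" for d
    using that unfolding inside_def F by blast
  have f1: "frame_ok G ?D {} (if r = [] then {} else {entry fr'}) F" unfolding frame_ok_def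
  proof (intro conjI ballI impI)
    fix d assume d: "d \<in> passed F" "d \<in> G"
    then consider "d = ?c" | "d \<in> passed fr'" using adv(2) by blast
    then have "both_ways ?D d \<and> inside (block F) d"
      by cases (use both_c inside_c both inside_F fr'(5) d(2) in blast)+
    then show "both_ways ?D d" "inside (block F) d" by blast+
  next
    fix d z assume z: "z \<in> block F - {node F}" and d: "d \<in> incident G z"
    have "both_ways ?D d \<and> inside (block F) d"
    proof (cases "z \<in> block fr")
      case True
      show ?thesis
      proof (cases "d = ?c")
        case False
        then show ?thesis using block_finished[OF ok e True d] both inside_F by blast
      qed (use both_c inside_c in blast)
    next
      case False
      then have "z \<in> block fr'" "z \<noteq> ?y" using z F by auto
      then show ?thesis using fr'(6)[OF _ _ d] both inside_F by blast
    qed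
    then show "both_ways ?D d" "inside (block F) d" by blast+
  next
    show "snd ` ?D \<inter> incident B (node F) \<subseteq> passed F \<union> (if r = [] then {} else {entry fr'})"
      using fr'(7) adv(3) unfolding sD F by blast
  next
    fix d assume "d \<in> graph F - G"
    then show "Inl (fst d) \<in> {} \<union> block F" using fr'(8)[of d] unfolding F by blast
  qed (use fr'(1-4) in \<open>auto simp: F\<close>)
  have new: "?x \<noteq> node g" if "g \<in> set r" for g
    using node_in_visited[OF r_ok that] x ok'(3) by auto
  have f2: "linked G ?D F (hd r)" if "r \<noteq> []"
  proof -
    have "?y \<noteq> ?x" using ent(1) x by auto
    then show ?thesis using link'[OF that] unfolding linked_def F by auto
  qed
  have f3: "stack_ok G ?D (block F) {entry fr'} r"
  proof (rule stack_ok_mono[OF r_ok])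
    have "?c \<in> snd ` D" using c(2) by force
    moreover have "z = ?x" "d = ?c" if "(z, d) \<in> ?D - D" for z d using that by auto
    ultimately show "z \<noteq> node g \<and> (d \<in> snd ` D \<or> d \<notin> incident B (node g))"
      if "(z, d) \<in> ?D - D" "g \<in> set r" for z d g
      using that new[OF that(2)] by metis
  qed (use ok'(13) in \<open>auto simp: F\<close>)
  have vis: "visited (F # r) = visited (fr # fr' # r)" by (simp add: F Un_assoc)
  have "state_ok G ?D (F # r)" unfolding state_ok_def vis sD
  proof (intro conjI)
    show "stack_ok G ?D {} {} (F # r)"
      using f1 f2 f3 ok'(3) disj' by (auto simp: F)
    show "?D \<subseteq> {(x, d). d \<in> incident G x}" using ok'(7) ent(4) by blast
    show "\<forall>d. (Inl (fst d), d) \<in> ?D \<longrightarrow> \<not> P (G - {d})"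
    proof (intro allI impI)
      show "\<not> P (G - {d})" if "(Inl (fst d), d) \<in> ?D" for d
        using that ok'(8)[of d] mand[of "fst d"] by auto
    qed
    show "pointer (hd (F # r)) \<in> incident G (node (hd (F # r)))"
      using m(2,3) adv(1) by (simp add: F)
  qed (use ok'(5,6,9,10,11) in auto)
  moreover have "pointer F = next_edge \<rho> G ?y ?c" using m(2) adv(1) by simp
  ultimately show ?thesis unfolding F_def by blast
qed

text \<open>At a violet node a traversed edge is either passed, hence already traversed from its
  violet end, or it is the entry edge after a full turn, hence a bridge. So removals never hit a
  traversed edge.\<close>

lemma not_removable:
  assumes ok: "state_ok G D (fr # r)" and x: "node fr = Inl v" and c: "pointer fr \<in> snd ` D"
  shows "\<not> P (G - {pointer fr})"
proof -
  note ok' = state_okD[OF ok]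
  have cG: "pointer fr \<in> G" "v = fst (pointer fr)" "pointer fr \<in> incident B (node fr)"
    using ok'(5,12) x unfolding incident_iff by auto
  then consider "pointer fr \<in> passed fr" | "r \<noteq> []" "pointer fr = entry fr"
    using frame_okD(7)[OF ok'(1)] c by (auto split: if_splits)
  then show ?thesis
  proof cases
    case 1
    then show ?thesis using frame_okD(5)[OF ok'(1) _ cG(1)] ok'(8) unfolding both_ways_def by blast
  next
    case 2
    then show ?thesis using entry_bridge[OF ok] hypertree_E_connected by metis
  qed
qed

text \<open>By \<open>not_removable\<close> the removed edge is untraversed, so \<open>D\<close>
  still lives in the smaller graph. The frame keeps its stored graph, whose new missing edge ends at
  the violet node of the frame itself.\<close>

lemma state_remove:
  assumes ok: "state_ok G D (fr # r)" and x: "node fr = Inl v" and P: "P (G - {pointer fr})"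
  shows "\<exists>n. state_ok (G - {pointer fr}) D
      (Frame (node fr) (entry fr) n (block fr) (graph fr) # r) \<and>
    pointer (Frame (node fr) (entry fr) n (block fr) (graph fr)) =
      next_edge \<rho> G (node fr) (pointer fr)"
proof -
  note ok' = state_okD[OF ok]
  note fr = frame_okD[OF ok'(1)]
  let ?c = "pointer fr" and ?x = "node fr"
  let ?G = "G - {?c}"
  have cD: "?c \<notin> snd ` D" using not_removable[OF ok x] P by blast
  have cB: "?c \<in> incident B ?x" using ok'(5,12) unfolding incident_iff by blast
  \<comment> \<open>Connectivity after the removal leaves some edge at the node; it makes the next
    edge differ from the removed one.\<close>
  obtain d where d: "d \<in> incident ?G ?x"
    using connected_incident[OF hypertree_E_connected[OF P] incident_node[OF cB] nonempty] by blast
  then have d': "d \<in> incident G ?x" "d \<noteq> ?c" unfolding incident_iff by auto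
  obtain m where m: "0 < m" "next_edge \<rho> G ?x ?c = (\<rho> ?x ^^ m) ?c"
    "next_edge \<rho> G ?x ?c \<in> incident G ?x" "next_edge \<rho> G ?x ?c \<noteq> ?c"
    and gap: "\<And>j. 0 < j \<Longrightarrow> j < m \<Longrightarrow> (\<rho> ?x ^^ j) ?c \<notin> G"
    by (rule next_edge_in_subgraphE[OF ok'(5) cB d'(1)]) (use d'(2) in blast)
  define F where "F = Frame ?x (entry fr) (rank fr + m) (block fr) (graph fr)"
  have F: "node F = ?x" "entry F = entry fr" "rank F = rank fr + m"
    "block F = block fr" "graph F = graph fr"
    unfolding F_def by simp_all
  note adv = passed_advance[OF F(1-3) gap m(1) fr(3)]
  have cx: "Inl (fst ?c) = ?x" using ok'(12) x unfolding incident_iff by auto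
  have f1: "frame_ok ?G D {} (if r = [] then {} else {entry fr}) F" unfolding frame_ok_def
  proof (intro conjI ballI impI)
    fix d assume "d \<in> passed F" "d \<in> ?G"
    then have "d \<in> passed fr" "d \<in> G" using adv(2) by blast+
    then show "both_ways D d" "inside (block F) d" using fr(5) unfolding F by blast+
  next
    fix d z assume "z \<in> block F - {node F}" "d \<in> incident ?G z"
    then have "z \<in> block fr" "z \<noteq> ?x" "d \<in> incident G z" unfolding F incident_iff by auto
    then show "both_ways D d" "inside (block F) d" using fr(6) unfolding F by blast+
  next
    show "snd ` D \<inter> incident B (node F) \<subseteq> passed F \<union> (if r = [] then {} else {entry fr})"
      using fr(7) adv(3) unfolding F by blast
  next
    fix d assume d: "d \<in> graph F - ?G"
    show "Inl (fst d) \<in> {} \<union> block F"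
      using fr(8)[of d] d cx fr(1) unfolding F by (cases "d = ?c") auto
  qed (use fr(1-4) in \<open>auto simp: F\<close>)
  have f2: "linked ?G D F (hd r)" if "r \<noteq> []"
  proof -
    have "entry fr \<noteq> ?c" using ok'(2)[OF that] cD unfolding linked_def by force
    then show ?thesis using ok'(2)[OF that] unfolding linked_def F incident_iff by auto
  qed
  have "Inl (fst d) \<in> block fr" if "d \<in> G - ?G" for d using that cx fr(1) by auto
  moreover have "snd ` D \<subseteq> ?G" using ok'(13) cD by blast
  ultimately have f3: "stack_ok ?G D (block fr) {entry fr} r"
    by (intro stack_ok_mono[OF ok'(4)]) auto
  have vis: "visited (F # r) = visited (fr # r)" by (simp add: F)
  have "state_ok ?G D (F # r)" unfolding state_ok_def vis
  proof (intro conjI)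
    show "stack_ok ?G D {} {} (F # r)" using f1 f2 f3 ok'(3) by (auto simp: F)
    show "D \<subseteq> {(x, d). d \<in> incident ?G x}"
    proof (rule subsetI, clarify)
      fix z a b assume d: "(z, a, b) \<in> D"
      then have "(a, b) \<noteq> ?c" using cD by force
      then show "(a, b) \<in> incident ?G z" using d ok'(7) unfolding incident_iff by auto
    qed
    show "\<forall>d. (Inl (fst d), d) \<in> D \<longrightarrow> \<not> P (?G - {d})"
    proof (intro allI impI notI)
      fix d assume "(Inl (fst d), d) \<in> D" and "P (?G - {d})"
      \<comment> \<open>A realization in the smaller graph is also one in the larger graph, so
        indispensable edges stay indispensable.\<close>
      moreover from this(2) have "P (G - {d})"
        unfolding hypertree_E_def using spanning_tree_mono[of V E "?G - {d}" _ "G - {d}"] by blast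
      ultimately show False using ok'(8) by blast
    qed
    show "pointer (hd (F # r)) \<in> incident ?G (node (hd (F # r)))"
      using m(2-4) adv(1) unfolding incident_iff by (simp add: F)
  qed (use ok'(5,9,10,11) P in auto)
  moreover have "pointer F = next_edge \<rho> G ?x ?c" using m(2) adv(1) by simp
  ultimately show ?thesis unfolding F_def by blast
qed


section \<open>Comparison of the two processes\<close>

text \<open>Each emerald frame except the base node was entered by a decision to keep its entry edge; as
  long as the frame is open, it is not known whether the (ht:\<open>V\<close>, cut:\<open>V\<close>) process decides likewise.\<close>

definition decisions_agree :: "('v, 'e) bigraph \<Rightarrow> ('v, 'e) frame list \<Rightarrow> bool" where
  "decisions_agree T st \<longleftrightarrow> (\<forall>fr\<in>set (butlast st). \<forall>e. node fr = Inr e \<longrightarrow>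
     \<not> hypertree_V V E (f_V T) (graph fr - {entry fr}))"

lemma decisions_agree_cong:
  assumes "node fr = node fr'" "entry fr = entry fr'" "graph fr = graph fr'"
  shows "decisions_agree T (fr # r) \<longleftrightarrow> decisions_agree T (fr' # r)"
  using assms unfolding decisions_agree_def by simp

text \<open>The finished block serves as the cut in \<open>not_hypertree_V_cut\<close>. The entry
  edge has its violet end outside the block, so the edges of \<open>T\<close> at violet nodes of the
  block stay inside. An edge of \<open>graph fr\<close> other than the entry edge, at an emerald
  node of the block, either survives in \<open>G\<close> and stays inside, or was removed at a
  violet node of the block.\<close>

lemma entry_not_hypertree_V:
  assumes ok: "state_ok G D (fr # r)" and r: "r \<noteq> []" and e: "pointer fr = entry fr"
    and x: "node fr = Inr \<epsilon>" and T: "spanning_tree V E G T"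
  shows "\<not> hypertree_V V E (f_V T) (graph fr - {entry fr})"
proof (rule not_hypertree_V_cut[OF fin _ T])
  note ok' = state_okD[OF ok]
  note fr = frame_okD[OF ok'(1)]
  show "G \<subseteq> V \<times> E" using ok'(5) by (rule subset_Bip)
  show "graph fr - {entry fr} \<subseteq> V \<times> E" using fr(4) subset_Bip by blast
  show "block fr \<subset> V <+> E" using ok'(9) entry_crosses(1,2)[OF ok r] by auto
  show "block fr \<noteq> {}" using fr(1) by blast
  have violet: "Inl (fst (entry fr)) = node (hd r)" using entry_crosses(5)[OF ok r] x by simp
  show "Inr (snd d) \<in> block fr" if d: "d \<in> T" "Inl (fst d) \<in> block fr" for d
  proof -
    have "d \<in> incident G (Inl (fst d))" using d(1) T unfolding spanning_tree_def incident_iff by blast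
    moreover have "d \<noteq> entry fr" using d(2) violet entry_crosses(1)[OF ok r] by metis
    ultimately show ?thesis using block_finished[OF ok e d(2)] unfolding inside_def by blast
  qed
  show "Inl (fst d) \<in> block fr" if d: "d \<in> graph fr - {entry fr}" "Inr (snd d) \<in> block fr" for d
  proof (cases "d \<in> G")
    case True
    then have "d \<in> incident G (Inr (snd d))" unfolding incident_iff by blast
    then show ?thesis using block_finished[OF ok e d(2)] d(1) unfolding inside_def by blast
  next
    case False
    then show ?thesis using fr(8)[of d] d(1) by blast
  qed
qed (rule nonempty)

text \<open>Agreement is passed backwards, from the later stack to the earlier one, because the
  verdict on a kept edge is known only when its frame closes. On a push from a violet node it is the
  clause for the new frame. On a pop, an emerald frame is settled by
  \<open>entry_not_hypertree_V\<close> and a violet one by \<open>entry_bridge\<close>.\<close>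

lemma state_traverse:
  assumes ok: "state_ok G D (fr # r)" and new: "(node fr, pointer fr) \<notin> D"
    and mand: "\<And>v. node fr = Inl v \<Longrightarrow> \<not> P (G - {pointer fr})"
  shows "\<exists>st. state_ok G (insert (node fr, pointer fr) D) st \<and>
    node (hd st) = opposite (node fr) (pointer fr) \<and>
    pointer (hd st) = next_edge \<rho> G (opposite (node fr) (pointer fr)) (pointer fr) \<and>
    (\<forall>T. spanning_tree V E G T \<longrightarrow> decisions_agree T st \<longrightarrow> decisions_agree T (fr # r) \<and>
      (\<forall>v. node fr = Inl v \<longrightarrow> \<not> hypertree_V V E (f_V T) (G - {pointer fr})))"
proof (cases "pointer fr \<in> snd ` D")
  case False
  obtain m where m: "state_ok G (insert (node fr, pointer fr) D)
      (Frame (opposite (node fr) (pointer fr)) (pointer fr) m {opposite (node fr) (pointer fr)} G # fr # r)"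
    "pointer (Frame (opposite (node fr) (pointer fr)) (pointer fr) m {opposite (node fr) (pointer fr)} G) =
      next_edge \<rho> G (opposite (node fr) (pointer fr)) (pointer fr)"
    using state_push[OF ok False] mand by blast
  show ?thesis
    by (rule exI, rule conjI[OF m(1)]) (use m(2) in \<open>auto simp: decisions_agree_def\<close>)
next
  case True
  note ok' = state_okD[OF ok]
  have "pointer fr \<in> incident B (node fr)" using ok'(5,12) unfolding incident_iff by blast
  \<comment> \<open>Passed edges of \<open>G\<close> have been traversed both ways, so a traversed
    edge that is new from this end must be the entry edge.\<close>
  moreover have "pointer fr \<notin> passed fr"
    using frame_okD(5)[OF ok'(1), of "pointer fr"] opposite_iff(3)[OF ok'(12), of D] ok'(12) new
    unfolding incident_iff by blast
  ultimately have r: "r \<noteq> []" and e: "pointer fr = entry fr"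
    using frame_okD(7)[OF ok'(1)] True by (auto split: if_splits)
  obtain fr' r' where r': "r = fr' # r'" using r by (cases r) auto
  have opp: "opposite (node fr) (entry fr) = node fr'" using entry_crosses(5)[OF ok r] r' by simp
  have mand': "\<not> P (G - {entry fr})" if "node fr = Inl v" for v using mand[OF that] e by simp
  obtain n where n: "state_ok G (insert (node fr, entry fr) D)
      (Frame (node fr') (entry fr') n (block fr \<union> block fr') (graph fr') # r')"
    "pointer (Frame (node fr') (entry fr') n (block fr \<union> block fr') (graph fr')) =
      next_edge \<rho> G (node fr') (entry fr)"
    using state_pop[OF ok[unfolded r'] e] mand' by blast
  have "decisions_agree T (fr # r) \<and> (\<forall>v. node fr = Inl v \<longrightarrow> \<not> hypertree_V V E (f_V T) (G - {pointer fr}))"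
    if T: "spanning_tree V E G T"
      and g: "decisions_agree T (Frame (node fr') (entry fr') n (block fr \<union> block fr') (graph fr') # r')" for T
  proof
    have "decisions_agree T r" using g decisions_agree_cong[of fr' "Frame (node fr') (entry fr') n _ (graph fr')"] r' by simp
    then show "decisions_agree T (fr # r)"
      using entry_not_hypertree_V[OF ok r e _ T] r unfolding decisions_agree_def by auto
    show "\<forall>v. node fr = Inl v \<longrightarrow> \<not> hypertree_V V E (f_V T) (G - {pointer fr})"
      using entry_bridge[OF ok r e] hypertree_V_connected e by metis
  qed
  then show ?thesis
    by (intro exI[of _ "Frame (node fr') (entry fr') n (block fr \<union> block fr') (graph fr') # r'"])
      (use n e opp in auto)
qed

text \<open>A repeated traversal means that the rotation has come round with all surviving edges at
  the node traversed both ways. The entry edge of a frame above the base has not been traversed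
  back, so this is the base node. Its block has no outgoing edge in \<open>G\<close>, hence contains
  every node, and the edge count makes \<open>G\<close> a tree.\<close>

lemma state_blocked:
  assumes ok: "state_ok G D (fr # r)" and old: "(node fr, pointer fr) \<in> D"
  shows "r = []" and "spanning_tree V E G G"
proof -
  note ok' = state_okD[OF ok]
  note fr = frame_okD[OF ok'(1)]
  have cB: "pointer fr \<in> incident B (node fr)" using ok'(5,12) unfolding incident_iff by blast
  have "pointer fr \<noteq> entry fr" if "r \<noteq> []"
    using ok'(2)[OF that] old unfolding linked_def by metis
  moreover have "pointer fr \<in> snd ` D" using old by force
  ultimately have "pointer fr \<in> passed fr" using fr(7) cB by (auto split: if_splits)
  then obtain j where j: "pointer fr = (\<rho> (node fr) ^^ j) (entry fr)" "1 \<le> j" "j < rank fr"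
    unfolding passed_def by blast
  have all: "d \<in> passed fr" if "d \<in> incident B (node fr)" for d
  proof -
    \<comment> \<open>The pointer is back at the edge of position \<open>j\<close>, so the positions
      from \<open>j\<close> on already cover the whole rotation.\<close>
    have "d \<in> {(\<rho> (node fr) ^^ i) (entry fr) | i. j \<le> i \<and> i < rank fr}"
      using cyclic_on_segment[OF cyclic[OF incident_node[OF fr(2)]] fr(2) j(1)[unfolded pointer_def, symmetric] j(3)]
        that by simp
    then show ?thesis using j(2) unfolding passed_def by fastforce
  qed
  show r: "r = []"
  proof (rule ccontr)
    assume r: "r \<noteq> []"
    have "both_ways D (entry fr)"
      using fr(5)[OF all[OF fr(2)]] entry_crosses(4)[OF ok r] unfolding incident_iff by blast
    then have "(node fr, entry fr) \<in> D" using opposite_iff(3)[OF fr(2)] by blast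
    then show False using ok'(2)[OF r] unfolding linked_def by blast
  qed
  have inner: "both_ways D d \<and> inside (block fr) d" if d: "d \<in> incident G z" and z: "z \<in> block fr" for d z
  proof (cases "z = node fr")
    case True
    then have "d \<in> incident B (node fr)" "d \<in> G" using d ok'(5) unfolding incident_iff by auto
    then show ?thesis using fr(5) all by blast
  next
    case False
    then show ?thesis using fr(6)[OF z _ d] by blast
  qed
  have con: "connected_graph V E G" using hypertree_E_connected[OF ok'(6)] .
  have "V <+> E \<subseteq> block fr"
  proof (rule subsetI, rule ccontr)
    fix y assume y: "y \<in> V <+> E" "y \<notin> block fr"
    obtain d where d: "d \<in> G" "crosses (block fr) d"
      using connected_crosses[OF con incident_node[OF fr(2)] fr(1) y] .
    then obtain z where "z \<in> block fr" "d \<in> incident G z" unfolding crosses_def incident_iff by blast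
    then show False using inner d(2) unfolding inside_def crosses_def by blast
  qed
  then have N: "block fr = V <+> E" using ok'(9) by auto
  have "d \<in> snd ` D" if d: "d \<in> G" for d
  proof -
    have "d \<in> incident G (Inl (fst d))" "Inl (fst d) \<in> block fr"
      using d subset_Bip[OF ok'(5)] N unfolding incident_iff by auto
    then have "(Inl (fst d), d) \<in> D" using inner unfolding both_ways_def by blast
    then show ?thesis by force
  qed
  then have "snd ` D = G" using ok'(13) by blast
  then have "card G + 1 = card (V <+> E)" using ok'(10) r N by simp
  then show "spanning_tree V E G G"
    using con spanning_tree_iff_card[OF fin subset_Bip[OF ok'(5)]] by blast
qed

lemma state_start:
  assumes P: "P B" and d: "d \<in> incident B x"
  shows "\<exists>s. state_ok B {} [Frame x s 1 {x} B] \<and> pointer (Frame x s 1 {x} B) = d"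
proof -
  have x: "x \<in> V <+> E" using incident_node[OF d] .
  have "d \<in> orbit (\<rho> x) d" using cyclic[OF x] d unfolding cyclic_on_alldef by blast
  then obtain n where n: "0 < n" "d = (\<rho> x ^^ n) d" unfolding orbit_altdef by blast
  then obtain k where k: "n = Suc k" by (metis gr0_implies_Suc)
  define s where "s = (\<rho> x ^^ k) d"
  have s: "s \<in> incident B x" unfolding s_def using cyclic_on_funpow_in[OF cyclic[OF x] d] .
  have p: "pointer (Frame x s 1 {x} B) = d" using n(2) k unfolding pointer_def s_def by simp
  have "frame_ok B {} {} {} (Frame x s 1 {x} B)" using s unfolding frame_ok_def passed_def by auto
  then have "state_ok B {} [Frame x s 1 {x} B]"
    using P x d p unfolding state_ok_def by simp
  then show ?thesis using p by blast
qed

text \<open>The hypertree \<open>f_V T\<close> is fixed only by the final tree, so the run is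
  claimed for all spanning trees of the current graph for which the pending decisions turn out to
  agree.\<close>

definition shadowed where
  "shadowed s\<^sub>0 s \<longleftrightarrow> (case s of (G, d, D) \<Rightarrow> \<exists>fr r. state_ok G D (fr # r) \<and>
     node fr = Inl (fst d) \<and> pointer fr = d \<and>
     (\<forall>T. spanning_tree V E G T \<longrightarrow> decisions_agree T (fr # r) \<longrightarrow>
       (cutV_step \<rho> (hypertree_V V E (f_V T)))\<^sup>*\<^sup>* s\<^sub>0 (G, d, D)))"

lemma state_okE:
  assumes "state_ok G D st"
  obtains fr r where "st = fr # r"
  using assms unfolding state_ok_def by (cases st) auto

text \<open>A spanning tree of the new graph is also one of the old graph. If an edge was removed,
  the tree avoids it, so \<open>f_V T\<close> is a hypertree without it. A traversal consists of two
  moves, of which only the one from the violet end involves a decision.\<close>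

lemma shadowed_step:
  assumes "cutV_step \<rho> P s s'" and "shadowed s\<^sub>0 s"
  shows "shadowed s\<^sub>0 s'"
  using assms
proof cases
  case (remove G v e D)
  obtain fr r where ok: "state_ok G D (fr # r)" and fr: "node fr = Inl v" "pointer fr = (v, e)"
    and run: "\<And>T. spanning_tree V E G T \<Longrightarrow> decisions_agree T (fr # r) \<Longrightarrow>
      (cutV_step \<rho> (hypertree_V V E (f_V T)))\<^sup>*\<^sup>* s\<^sub>0 (G, (v, e), D)"
    using assms(2) remove(1) unfolding shadowed_def by auto
  let ?G = "G - {(v, e)}" and ?d = "next_edge \<rho> G (Inl v) (v, e)"
  obtain n where n: "state_ok ?G D (Frame (node fr) (entry fr) n (block fr) (graph fr) # r)"
    "pointer (Frame (node fr) (entry fr) n (block fr) (graph fr)) = ?d"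
    using state_remove[OF ok fr(1)] remove(3) fr by auto
  have "Inl v = Inl (fst ?d)"
    using state_okD(12)[OF n(1)] n(2) fr(1) unfolding incident_iff by auto
  moreover have "(cutV_step \<rho> (hypertree_V V E (f_V T)))\<^sup>*\<^sup>* s\<^sub>0 (?G, ?d, D)"
    if T: "spanning_tree V E ?G T"
      and g: "decisions_agree T (Frame (node fr) (entry fr) n (block fr) (graph fr) # r)" for T
  proof -
    have "decisions_agree T (fr # r)" using g decisions_agree_cong[of fr "Frame (node fr) (entry fr) n _ (graph fr)"] by simp
    moreover have "spanning_tree V E G T" by (rule spanning_tree_mono[OF T]) blast
    moreover have "finite T"
      using T state_okD(5)[OF n(1)] finite_subgraph unfolding spanning_tree_def by (meson order_trans)
    then have "cutV_step \<rho> (hypertree_V V E (f_V T)) (G, (v, e), D) (?G, ?d, D)"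
      by (intro cutV_step.remove hypertree_V_f_V[OF T] nonempty)
    ultimately show ?thesis using run by (meson rtranclp.rtrancl_into_rtrancl)
  qed
  ultimately show ?thesis unfolding remove(2) shadowed_def using n fr(1)
    by (auto intro!: exI[of _ "Frame (node fr) (entry fr) n (block fr) (graph fr)"] exI[of _ r])
next
  case (traverse G v e D w)
  obtain fr r where ok: "state_ok G D (fr # r)" and fr: "node fr = Inl v" "pointer fr = (v, e)"
    and run: "\<And>T. spanning_tree V E G T \<Longrightarrow> decisions_agree T (fr # r) \<Longrightarrow>
      (cutV_step \<rho> (hypertree_V V E (f_V T)))\<^sup>*\<^sup>* s\<^sub>0 (G, (v, e), D)"
    using assms(2) traverse(1) unfolding shadowed_def by auto
  obtain st1 where st1: "state_ok G (insert (Inl v, (v, e)) D) st1" "node (hd st1) = Inr e"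
    "pointer (hd st1) = (w, e)"
    "\<And>T. spanning_tree V E G T \<Longrightarrow> decisions_agree T st1 \<Longrightarrow>
      decisions_agree T (fr # r) \<and> \<not> hypertree_V V E (f_V T) (G - {(v, e)})"
    using state_traverse[OF ok] fr traverse(3-5) by auto
  obtain fr1 r1 where fr1: "st1 = fr1 # r1" using st1(1) by (rule state_okE)
  have "\<exists>st2. state_ok G (insert (Inr e, (w, e)) (insert (Inl v, (v, e)) D)) st2 \<and>
    node (hd st2) = Inl w \<and> pointer (hd st2) = next_edge \<rho> G (Inl w) (w, e) \<and>
    (\<forall>T. spanning_tree V E G T \<longrightarrow> decisions_agree T st2 \<longrightarrow> decisions_agree T st1)"
    using state_traverse[OF st1(1)[unfolded fr1]] st1(2,3) traverse(6) fr1 by auto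
  then obtain fr2 r2 where st2:
    "state_ok G (insert (Inr e, (w, e)) (insert (Inl v, (v, e)) D)) (fr2 # r2)"
    "node fr2 = Inl w" "pointer fr2 = next_edge \<rho> G (Inl w) (w, e)"
    "\<And>T. spanning_tree V E G T \<Longrightarrow> decisions_agree T (fr2 # r2) \<Longrightarrow> decisions_agree T st1"
    by (metis state_okE list.sel(1))
  let ?d = "next_edge \<rho> G (Inl w) (w, e)" and ?D = "D \<union> {(Inl v, (v, e)), (Inr e, (w, e))}"
  have D: "insert (Inr e, (w, e)) (insert (Inl v, (v, e)) D) = ?D" by blast
  have "Inl w = Inl (fst ?d)"
    using state_okD(12)[OF st2(1)] st2(2,3) unfolding incident_iff by auto
  moreover have "(cutV_step \<rho> (hypertree_V V E (f_V T)))\<^sup>*\<^sup>* s\<^sub>0 (G, ?d, ?D)"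
    if T: "spanning_tree V E G T" and g: "decisions_agree T (fr2 # r2)" for T
  proof -
    have "decisions_agree T (fr # r)" and no: "\<not> hypertree_V V E (f_V T) (G - {(v, e)})"
      using st1(4)[OF T st2(4)[OF T g]] by blast+
    then have "(cutV_step \<rho> (hypertree_V V E (f_V T)))\<^sup>*\<^sup>* s\<^sub>0 (G, (v, e), D)" using run T by blast
    moreover have "cutV_step \<rho> (hypertree_V V E (f_V T)) (G, (v, e), D) (G, ?d, ?D)"
      using no traverse(4-6) by (rule cutV_step.traverse)
    ultimately show ?thesis by (rule rtranclp.rtrancl_into_rtrancl)
  qed
  ultimately show ?thesis unfolding traverse(2) shadowed_def using st2(1-3) D
    by (auto intro!: exI[of _ fr2] exI[of _ r2])
qed

text \<open>The process is blocked at the violet end or, one move later, at the emerald one. By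
  \<open>state_blocked\<close> only the base frame is then left, so no decision is pending, and the
  final graph is itself a tree to which the shadowed run applies.\<close>

lemma shadowed_final:
  assumes sh: "shadowed s\<^sub>0 (T, d, D)" and stuck: "\<nexists>s. cutV_step \<rho> P (T, d, D) s"
  shows "spanning_tree V E B T"
    and "(cutV_step \<rho> (hypertree_V V E (f_V T)))\<^sup>*\<^sup>* s\<^sub>0 (T, d, D)"
    and "\<nexists>s. cutV_step \<rho> (hypertree_V V E (f_V T)) (T, d, D) s"
proof -
  obtain v e where d: "d = (v, e)" by fastforce
  obtain fr r where ok: "state_ok T D (fr # r)" and fr: "node fr = Inl v" "pointer fr = (v, e)"
    and run: "\<And>T'. spanning_tree V E T T' \<Longrightarrow> decisions_agree T' (fr # r) \<Longrightarrow>
      (cutV_step \<rho> (hypertree_V V E (f_V T')))\<^sup>*\<^sup>* s\<^sub>0 (T, d, D)"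
    using sh d unfolding shadowed_def by auto
  have stuck': "\<not> cutV_step \<rho> P (T, (v, e), D) s" for s using stuck d by blast
  have mand: "\<not> P (T - {(v, e)})"
    using stuck'[of "(T - {(v, e)}, next_edge \<rho> T (Inl v) (v, e), D)"] cutV_step.remove[of P T v e \<rho> D]
    by satx
  have no_traverse: "(Inr e, (w, e)) \<in> D"
    if "(Inl v, (v, e)) \<notin> D" "next_edge \<rho> T (Inr e) (v, e) = (w, e)" for w
    using stuck' cutV_step.traverse[where P = P and G = T and v = v and e = e and D = D and
      \<rho> = \<rho> and w = w] mand that by blast
  have TB: "T \<subseteq> B" and de: "(v, e) \<in> T" using state_okD(5,12)[OF ok] fr unfolding incident_iff by auto
  have "spanning_tree V E T T \<and> decisions_agree T (fr # r)"
  proof (cases "(Inl v, (v, e)) \<in> D")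
    case True
    then show ?thesis using state_blocked[OF ok] fr unfolding decisions_agree_def by simp
  next
    case False
    \<comment> \<open>The process does not perform this half of a traversal; it is carried out here
      to reach the blocked state at \<open>e\<close>.\<close>
    obtain st1 where st1: "state_ok T (insert (Inl v, (v, e)) D) st1" "node (hd st1) = Inr e"
      "pointer (hd st1) = next_edge \<rho> T (Inr e) (v, e)"
      "\<And>T'. spanning_tree V E T T' \<Longrightarrow> decisions_agree T' st1 \<Longrightarrow> decisions_agree T' (fr # r)"
      using state_traverse[OF ok] fr mand False by auto
    obtain fr1 r1 where fr1: "st1 = fr1 # r1" using st1(1) by (rule state_okE)
    obtain w where w: "pointer fr1 = (w, e)"
      using state_okD(12)[OF st1(1)[unfolded fr1]] st1(2) fr1 unfolding incident_iff
      by (cases "pointer fr1") auto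
    have "(Inr e, (w, e)) \<in> D"
      using no_traverse[OF False, of w] st1(3) w fr1 by simp
    then have "(node fr1, pointer fr1) \<in> insert (Inl v, (v, e)) D" using st1(2) w fr1 by simp
    note bl = state_blocked[OF st1(1)[unfolded fr1] this]
    then have "decisions_agree T st1" using fr1 unfolding decisions_agree_def by simp
    then show ?thesis using st1(4) bl(2) by blast
  qed
  then have T: "spanning_tree V E T T" and g: "decisions_agree T (fr # r)" by auto
  show "spanning_tree V E B T" using spanning_tree_mono[OF T TB] .
  show "(cutV_step \<rho> (hypertree_V V E (f_V T)))\<^sup>*\<^sup>* s\<^sub>0 (T, d, D)" using run[OF T g] .
  show "\<nexists>s. cutV_step \<rho> (hypertree_V V E (f_V T)) (T, d, D) s"
  proof
    assume "\<exists>s. cutV_step \<rho> (hypertree_V V E (f_V T)) (T, d, D) s"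
    then obtain s where "cutV_step \<rho> (hypertree_V V E (f_V T)) (T, (v, e), D) s" using d by blast
    then show False
    proof cases
      case remove
      have finT: "finite T" using TB by (rule finite_subgraph)
      \<comment> \<open>A spanning tree has no edge to spare, so the other process cannot remove one
        either.\<close>
      have "card (V <+> E) \<le> card (T - {(v, e)}) + 1"
        using hypertree_V_connected[OF remove(2)] finT fin by (intro card_connected) auto
      moreover have "card T + 1 = card (V <+> E)"
        using T spanning_tree_iff_card[OF fin subset_Bip[OF TB]] by blast
      ultimately show False using de finT by (metis Suc_eq_plus1 Suc_n_not_le_n card_Suc_Diff1)
    next
      case (traverse w)
      then show False using no_traverse by blast
    qed
  qed
qed

end

theorem theorem6p19:
  fixes V :: "'v set" and E :: "'e set" and A :: "'e \<Rightarrow> 'v set"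
    and \<rho> :: "'v + 'e \<Rightarrow> 'v \<times> 'e \<Rightarrow> 'v \<times> 'e"
    and b\<^sub>0 :: "'v + 'e" and d\<^sub>0 :: "'v \<times> 'e"
    and f :: "'e \<Rightarrow> nat" and T :: "('v, 'e) bigraph"
  assumes "hypergraph V E A"
    and "connected_graph V E (Bip V E A)"
    and "ribbon_structure V E (Bip V E A) \<rho>"
    and "b\<^sub>0 \<in> V <+> E" and "d\<^sub>0 \<in> incident (Bip V E A) b\<^sub>0"
    and "hypertree_E V E f (Bip V E A)"
    and "bernardi_EV V E A \<rho> b\<^sub>0 d\<^sub>0 f T"
  shows "hypertree_V V E (f_V T) (Bip V E A) \<and> bernardi_VV V E A \<rho> b\<^sub>0 d\<^sub>0 (f_V T) T"
proof -
  let ?B = "Bip V E A" and ?s = "cutV_start \<rho> (Bip V E A) b\<^sub>0 d\<^sub>0"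
  have "V \<noteq> {}" "E \<noteq> {}" using assms(5) unfolding incident_iff Bip_def by auto
  then interpret ribbon_hypergraph V E A \<rho> f
    using assms(1,3) by unfold_locales
  obtain s where s: "state_ok ?B {} [Frame b\<^sub>0 s 1 {b\<^sub>0} ?B]"
    "pointer (Frame b\<^sub>0 s 1 {b\<^sub>0} ?B) = d\<^sub>0"
    using state_start[OF assms(6,5)] by blast
  have start: "shadowed ?s ?s"
  proof (cases b\<^sub>0)
    case (Inl v)
    then have "v = fst d\<^sub>0" using assms(5) unfolding incident_iff by auto
    then show ?thesis using s Inl unfolding shadowed_def by auto
  next
    case (Inr e)
    let ?d = "next_edge \<rho> ?B (Inl (fst d\<^sub>0)) d\<^sub>0"
    \<comment> \<open>The base edge counts as traversed from the emerald base node, so the start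
      state lies one move after the initial frame.\<close>
    have "\<exists>st. state_ok ?B {(Inr e, d\<^sub>0)} st \<and> node (hd st) = Inl (fst d\<^sub>0) \<and> pointer (hd st) = ?d"
      using state_traverse[OF s(1)] s(2) Inr by auto
    then obtain fr r where fr: "state_ok ?B {(Inr e, d\<^sub>0)} (fr # r)" "node fr = Inl (fst d\<^sub>0)"
      "pointer fr = ?d"
      by (metis state_okE list.sel(1))
    moreover have "Inl (fst d\<^sub>0) = Inl (fst ?d)"
      using state_okD(12)[OF fr(1)] fr(2,3) unfolding incident_iff by auto
    ultimately show ?thesis using Inr unfolding shadowed_def by auto
  qed
  obtain d D where run: "(cutV_step \<rho> P)\<^sup>*\<^sup>* ?s (T, d, D)"
    and stuck: "\<nexists>s. cutV_step \<rho> P (T, d, D) s"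
    using assms(7) unfolding bernardi_EV_def cutV_result_def by blast
  from run have "shadowed ?s (T, d, D)"
    by (induction rule: rtranclp_induct) (use start shadowed_step in blast)+
  note final = shadowed_final[OF this stuck]
  have "finite T" using final(1) finite_subgraph unfolding spanning_tree_def by blast
  then have "hypertree_V V E (f_V T) ?B" using final(1) nonempty(2) by (intro hypertree_V_f_V)
  moreover have "bernardi_VV V E A \<rho> b\<^sub>0 d\<^sub>0 (f_V T) T"
    using final(2,3) unfolding bernardi_VV_def cutV_result_def by blast
  ultimately show ?thesis ..
qed

end
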